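(* Let $(\Omega,\mathcal{B},\mathbf{P},T)$ be an ergodic invertible measure-preserving dynamical system with observation $\sigma$-field $\mathcal{Y}\subseteq\mathcal{B}$, and suppose that $(\Omega,\mathcal{B},\mathbf{P},T)$ is a conditional $K$-automorphism relative to $\mathcal{Y}_{-\infty,0}$. Then for every measurable loss function $\ell:U\times\Omega\to\mathbb{R}$ such that $U$ is finite and $|\ell(u,\omega)|\le\Lambda(\omega)$ for all $(u,\omega)$ with $\Lambda\in L^1(\mathbf{P})$, the mean-optimal strategy $\mathbf{\tilde u}$ is pathwise optimal: for every admissible strategy $\mathbf{u}$, $$\liminf_{N\to\infty}\{L_N(\mathbf{u})-L_N(\mathbf{\tilde u})\}\ge 0\quad\text{a.s.}$$
   Context: Setting: $(\Omega,\mathcal{B},\mathbf{P})$ is a probability space, $\mathcal{Y}\subseteq\mathcal{B}$ a sub-$\sigma$-field, $T:\Omega\to\Omega$ an invertible (bimeasurable) measure-preserving ergodic transformation, $(U,\mathcal{U})$ a measurable space of decisions. For a $\sigma$-field $\mathcal{A}$ and $k\in\mathbb{Z}$, $T^k\mathcal{A}=\{T^kA:A\in\mathcal{A}\}$. For $-\infty\le m\le n\le\infty$, $\mathcal{Y}_{m,n}=\bigvee_{k=m}^n T^{-k}\mathcal{Y}$. For $m\le n$, $\mathbb{U}_{m,n}$ is the set of $\mathcal{Y}_{m,n}$-measurable maps $u:\Omega\to U$. Loss: for $n\in\mathbb{Z}$, $\ell_n(u)(\omega)=\ell(u,T^n\omega)$; for a random decision $u:\Omega\to U$, $\ell_n(u)(\omega)=\ell(u(\omega),T^n\omega)$.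 A strategy $\mathbf{u}=(u_k)_{k\ge1}$ is admissible if $u_k\in\mathbb{U}_{0,k}$ for every $k\ge 1$. Its time-average loss over horizon $N$ is $L_N(\mathbf{u})=\frac1N\sum_{k=1}^N\ell_k(u_k)$. Mean-optimal strategy: $\mathbf{\tilde u}=(\tilde u_k)_{k\ge1}$ denotes an (arbitrary, fixed) admissible strategy such that for every $k\ge1$, $\mathbf{E}[\ell_k(\tilde u_k)|\mathcal{Y}_{0,k}]\le \mathop{\mathrm{ess\,inf}}_{u\in\mathbb{U}_{0,k}}\mathbf{E}[\ell_k(u)|\mathcal{Y}_{0,k}]+k^{-1}$ a.s. (such a strategy always exists). Conditional $K$-automorphism: $(\Omega,\mathcal{B},\mathbf{P},T)$ is a conditional $K$-automorphism relative to a $\sigma$-field $\mathcal{Z}\subset\mathcal{B}$ if there is a $\sigma$-field $\mathcal{X}\subset\mathcal{B}$ such that (1) $\mathcal{X}\subset T^{-1}\mathcal{X}$; (2) $\bigvee_{k=1}^\infty T^{-k}\mathcal{X}=\mathcal{B}$ mod $\mathbf{P}$; (3) $\bigcap_{k=1}^\infty(\mathcal{Z}\vee T^k\mathcal{X})=\mathcal{Z}$ mod $\mathbf{P}$. *)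

theory Defs
  imports "HOL-Probability.Probability"
begin

text \<open>
  A sub-\<open>\<sigma>\<close>-field of \<open>M\<close> is represented by its collection of sets; \<open>sigma (space M) \<A>\<close> turns
  it into a measurable space where measurability or conditional expectation requires one.
\<close>

definition sub_field :: "'a measure \<Rightarrow> 'a set set \<Rightarrow> bool" where
  "sub_field M \<A> \<longleftrightarrow> sigma_algebra (space M) \<A> \<and> \<A> \<subseteq> sets M"

definition invertible_mpt :: "'a measure \<Rightarrow> ('a \<Rightarrow> 'a) \<Rightarrow> bool" where
  "invertible_mpt M T \<longleftrightarrow>
     bij_betw T (space M) (space M) \<and>
     T \<in> measurable M M \<and>
     inv_into (space M) T \<in> measurable M M \<and>
     distr M M T = M"

definition ergodic :: "'a measure \<Rightarrow> ('a \<Rightarrow> 'a) \<Rightarrow> bool" where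
  "ergodic M T \<longleftrightarrow>
     (\<forall>A\<in>sets M. T -` A \<inter> space M = A \<longrightarrow> measure M A = 0 \<or> measure M A = 1)"

text \<open>The inverse is taken on \<open>space M\<close>, as \<open>T\<close> need not be injective on the whole type.\<close>

definition iterate :: "'a measure \<Rightarrow> ('a \<Rightarrow> 'a) \<Rightarrow> int \<Rightarrow> 'a \<Rightarrow> 'a" where
  "iterate M T k =
     (if k \<ge> 0 then T ^^ nat k else inv_into (space M) T ^^ nat (- k))"

definition shift_field :: "'a measure \<Rightarrow> ('a \<Rightarrow> 'a) \<Rightarrow> int \<Rightarrow> 'a set set \<Rightarrow> 'a set set" where
  "shift_field M T k \<A> = (\<lambda>A. iterate M T k ` A) ` \<A>"

definition join_fields :: "'a measure \<Rightarrow> 'i set \<Rightarrow> ('i \<Rightarrow> 'a set set) \<Rightarrow> 'a set set" where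
  "join_fields M I \<F> = sigma_sets (space M) (\<Union>i\<in>I. \<F> i)"

definition join2 :: "'a measure \<Rightarrow> 'a set set \<Rightarrow> 'a set set \<Rightarrow> 'a set set" where
  "join2 M \<A> \<B> = sigma_sets (space M) (\<A> \<union> \<B>)"

text \<open>
  \<open>obs_field M T \<Y> I\<close> is the join of \<open>T\<^sup>-\<^sup>k \<Y>\<close> over \<open>k \<in> I\<close>. The possibly infinite range
  of times is given as a set of integers: \<open>\<Y>\<close> with indices \<open>m, n\<close> is \<open>I = {m..n}\<close>, and with
  indices \<open>-\<infinity>, n\<close> it is \<open>I = {..n}\<close>.
\<close>

definition obs_field :: "'a measure \<Rightarrow> ('a \<Rightarrow> 'a) \<Rightarrow> 'a set set \<Rightarrow> int set \<Rightarrow> 'a set set" where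
  "obs_field M T \<Y> I = join_fields M I (\<lambda>k. shift_field M T (- k) \<Y>)"

definition field_eq_mod :: "'a measure \<Rightarrow> 'a set set \<Rightarrow> 'a set set \<Rightarrow> bool" where
  "field_eq_mod M \<A> \<B> \<longleftrightarrow>
     (\<forall>A\<in>\<A>. \<exists>B\<in>\<B>. (A - B) \<union> (B - A) \<in> null_sets M) \<and>
     (\<forall>B\<in>\<B>. \<exists>A\<in>\<A>. (A - B) \<union> (B - A) \<in> null_sets M)"

definition conditional_K_automorphism ::
  "'a measure \<Rightarrow> ('a \<Rightarrow> 'a) \<Rightarrow> 'a set set \<Rightarrow> bool" where
  "conditional_K_automorphism M T \<Z> \<longleftrightarrow>
     (\<exists>\<X>. sub_field M \<X> \<and>
        \<X> \<subseteq> shift_field M T (- 1) \<X> \<and>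
        field_eq_mod M (join_fields M {1..} (\<lambda>k. shift_field M T (- k) \<X>)) (sets M) \<and>
        field_eq_mod M (\<Inter>k\<in>{1..}. join2 M \<Z> (shift_field M T k \<X>)) \<Z>)"

definition decisions ::
  "'a measure \<Rightarrow> ('a \<Rightarrow> 'a) \<Rightarrow> 'a set set \<Rightarrow> 'u measure \<Rightarrow> int \<Rightarrow> int \<Rightarrow> ('a \<Rightarrow> 'u) set" where
  "decisions M T \<Y> U m n = measurable (sigma (space M) (obs_field M T \<Y> {m..n})) U"

definition loss_at ::
  "'a measure \<Rightarrow> ('a \<Rightarrow> 'a) \<Rightarrow> ('u \<times> 'a \<Rightarrow> real) \<Rightarrow> int \<Rightarrow> ('a \<Rightarrow> 'u) \<Rightarrow> 'a \<Rightarrow> real" where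
  "loss_at M T l n u \<omega> = l (u \<omega>, iterate M T n \<omega>)"

text \<open>Strategies are indexed by \<open>k \<ge> 1\<close>; the value at index \<open>0\<close> is never used.\<close>

definition admissible ::
  "'a measure \<Rightarrow> ('a \<Rightarrow> 'a) \<Rightarrow> 'a set set \<Rightarrow> 'u measure \<Rightarrow> (nat \<Rightarrow> 'a \<Rightarrow> 'u) \<Rightarrow> bool" where
  "admissible M T \<Y> U u \<longleftrightarrow> (\<forall>k\<ge>1. u k \<in> decisions M T \<Y> U 0 (int k))"

definition average_loss ::
  "'a measure \<Rightarrow> ('a \<Rightarrow> 'a) \<Rightarrow> ('u \<times> 'a \<Rightarrow> real) \<Rightarrow> (nat \<Rightarrow> 'a \<Rightarrow> 'u) \<Rightarrow> nat \<Rightarrow> 'a \<Rightarrow> real" where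
  "average_loss M T l u N \<omega> = (1 / real N) * (\<Sum>k=1..N. loss_at M T l (int k) (u k) \<omega>)"

text \<open>
  \<open>is_ess_inf M F g\<close>: \<open>g\<close> is a version of the essential infimum of the (possibly uncountable)
  family \<open>F\<close> of random variables, i.e. the almost surely greatest measurable almost sure lower
  bound. It is determined up to null sets, hence a predicate rather than a function.
\<close>

definition is_ess_inf :: "'a measure \<Rightarrow> ('a \<Rightarrow> ereal) set \<Rightarrow> ('a \<Rightarrow> ereal) \<Rightarrow> bool" where
  "is_ess_inf M F g \<longleftrightarrow>
     g \<in> borel_measurable M \<and>
     (\<forall>f\<in>F. AE \<omega> in M. g \<omega> \<le> f \<omega>) \<and>
     (\<forall>h\<in>borel_measurable M. (\<forall>f\<in>F. AE \<omega> in M. h \<omega> \<le> f \<omega>) \<longrightarrow> (AE \<omega> in M. h \<omega> \<le> g \<omega>))"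

definition cond_loss ::
  "'a measure \<Rightarrow> ('a \<Rightarrow> 'a) \<Rightarrow> 'a set set \<Rightarrow> ('u \<times> 'a \<Rightarrow> real) \<Rightarrow> nat \<Rightarrow> ('a \<Rightarrow> 'u) \<Rightarrow> 'a \<Rightarrow> real" where
  "cond_loss M T \<Y> l k u =
     real_cond_exp M (sigma (space M) (obs_field M T \<Y> {0..int k})) (loss_at M T l (int k) u)"

definition mean_optimal ::
  "'a measure \<Rightarrow> ('a \<Rightarrow> 'a) \<Rightarrow> 'a set set \<Rightarrow> 'u measure \<Rightarrow> ('u \<times> 'a \<Rightarrow> real) \<Rightarrow>
    (nat \<Rightarrow> 'a \<Rightarrow> 'u) \<Rightarrow> bool" where
  "mean_optimal M T \<Y> U l v \<longleftrightarrow>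
     admissible M T \<Y> U v \<and>
     (\<forall>k\<ge>1. \<exists>g.
        is_ess_inf M {\<lambda>\<omega>. ereal (cond_loss M T \<Y> l k u \<omega>) | u. u \<in> decisions M T \<Y> U 0 (int k)} g \<and>
        (AE \<omega> in M. ereal (cond_loss M T \<Y> l k (v k) \<omega>) \<le> g \<omega> + ereal (1 / real k)))"

definition pathwise_optimal ::
  "'a measure \<Rightarrow> ('a \<Rightarrow> 'a) \<Rightarrow> 'a set set \<Rightarrow> 'u measure \<Rightarrow> ('u \<times> 'a \<Rightarrow> real) \<Rightarrow>
    (nat \<Rightarrow> 'a \<Rightarrow> 'u) \<Rightarrow> bool" where
  "pathwise_optimal M T \<Y> U l v \<longleftrightarrow>
     admissible M T \<Y> U v \<and>
     (\<forall>u. admissible M T \<Y> U u \<longrightarrow>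
        (AE \<omega> in M.
           liminf (\<lambda>N. ereal (average_loss M T l u N \<omega> - average_loss M T l v N \<omega>)) \<ge> 0))"

end

theory Submission
  imports Defs
begin

text \<open>
  Let \<open>h a\<close> be the conditional expectation of \<open>l (a, \<cdot>)\<close> given \<open>\<Y>\<close> with indices \<open>-\<infinity>, 0\<close>.

  A conditional law of large numbers lets \<open>l (u k x, T\<^sup>k x)\<close> be replaced by \<open>h (u k x) (T\<^sup>k x)\<close> in
  the time averages. By the \<open>K\<close>-property, \<open>f\<close> minus its conditional expectation given the past
  observations is, up to a small \<open>L\<^sup>1\<close> error, a finite sum of increments of conditional
  expectations along the decreasing fields generated by the past observations and
  \<open>T\<^sup>j \<X>\<close>. Along an orbit, and after multiplication by observable weights, each bounded
  increment gives orthogonal random variables, for which the strong law is elementary; the maximal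
  ergodic inequality controls the error.

  The mean-optimal strategy minimises, up to \<open>1/k\<close>, the conditional expectation of the loss
  given the finite past. The resulting excess of \<open>h\<close> over its minimum tends to \<open>0\<close> by Levy's
  upward theorem and is at most \<open>2 \<Sum>\<bar>h\<bar>\<close>. This bound is integrable, even though the supremum of the
  conditional expectations given the finite pasts need not be, so Maker's ergodic theorem applies.
\<close>

section \<open>Maximal ergodic inequality\<close>

text \<open>The ergodic theorem does not apply to \<open>l (u k x, T^k x)\<close> directly, since
  the decision changes with \<open>k\<close> and depends on all observations so far. For a fixed
  decision \<open>a\<close>, the indicator of choosing \<open>a\<close> at time \<open>k\<close> is
  a weight measurable for the indices \<open>0..k\<close>, and two facts keep such weights harmless.
  Shifted back by \<open>k\<close>, a weight becomes measurable for the observations up to time 0, a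
  field contained in every \<open>W j\<close>, the join of those observations with
  \<open>T^j \<X>\<close>. And shifting an increment between \<open>W j\<close> and
  \<open>W (j + 1)\<close> back by at least one step makes it measurable for
  \<open>W (j + 1)\<close>, given which the present increment has mean zero. So the weights never
  spoil orthogonality. The generating condition on \<open>\<X>\<close> recovers the function as
  \<open>j\<close> tends to minus infinity; the tail condition leaves only its conditional
  expectation on the past observations as \<open>j\<close> tends to infinity. Convergence in L1
  suffices for both limits: with weights bounded by 1, a single function of small integral dominates
  the error whatever the strategy, and the maximal inequality applies to that function.\<close>

lemma AE_summable:
  fixes f :: "nat \<Rightarrow> 'a \<Rightarrow> real"
  assumes int: "\<And>n. integrable M (f n)" and nn: "\<And>n x. 0 \<le> f n x"
    and sm: "summable (\<lambda>n. \<integral>x. f n x \<partial>M)"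
  shows "AE x in M. summable (\<lambda>n. f n x)"
proof -
  have [measurable]: "f n \<in> borel_measurable M" for n using int by auto
  have "(\<integral>\<^sup>+ x. (\<Sum>n. ennreal (f n x)) \<partial>M) = (\<Sum>n. \<integral>\<^sup>+ x. ennreal (f n x) \<partial>M)"
    by (rule nn_integral_suminf) simp
  also have "\<dots> = (\<Sum>n. ennreal (\<integral>x. f n x \<partial>M))"
    using int nn by (simp add: nn_integral_eq_integral)
  also have "\<dots> = ennreal (\<Sum>n. \<integral>x. f n x \<partial>M)"
    by (rule suminf_ennreal2) (auto simp: sm nn)
  finally have "AE x in M. (\<Sum>n. ennreal (f n x)) \<noteq> \<infinity>"
    by (intro nn_integral_PInf_AE) auto
  then show ?thesis
    by (rule AE_mp) (auto intro!: AE_I2 summable_suminf_not_top nn)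
qed

text \<open>For a fixed tolerance \<open>c\<close>, exceptional sets of measure at most
  \<open>(1/2)^i\<close> intersect in a null set; letting \<open>c\<close> run through
  \<open>1 / (j + 1)\<close> gives convergence. The set may depend on \<open>c\<close>, which is
  exactly what a maximal inequality delivers, ergodic or martingale.\<close>

lemma (in prob_space) AE_LIMSEQ_zero_if_small_exceptional_sets:
  fixes X :: "nat \<Rightarrow> 'a \<Rightarrow> real"
  assumes small: "\<And>c e. 0 < c \<Longrightarrow> 0 < e \<Longrightarrow>
    \<exists>A\<in>sets M. measure M A \<le> e \<and> (AE x in M. x \<notin> A \<longrightarrow> (\<forall>\<^sub>F n in sequentially. \<bar>X n x\<bar> \<le> c))"
  shows "AE x in M. (\<lambda>n. X n x) \<longlonglongrightarrow> 0"
proof -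
  have "AE x in M. \<forall>\<^sub>F n in sequentially. \<bar>X n x\<bar> \<le> c" if c: "0 < c" for c :: real
  proof -
    have "\<forall>i::nat. \<exists>A. A \<in> sets M \<and> measure M A \<le> (1/2)^i \<and>
        (AE x in M. x \<notin> A \<longrightarrow> (\<forall>\<^sub>F n in sequentially. \<bar>X n x\<bar> \<le> c))"
      using small[OF c] by (simp add: Bex_def)
    from choice[OF this] obtain A where A[measurable]: "\<And>i::nat. A i \<in> sets M"
      and m: "\<And>i. measure M (A i) \<le> (1/2)^i"
      and ae: "\<And>i. AE x in M. x \<notin> A i \<longrightarrow> (\<forall>\<^sub>F n in sequentially. \<bar>X n x\<bar> \<le> c)"
      by blast
    have "measure M (\<Inter>i. A i) \<le> 0"
    proof (rule LIMSEQ_le_const)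
      show "(\<lambda>i. (1/2::real)^i) \<longlonglongrightarrow> 0" by (rule LIMSEQ_realpow_zero) auto
      show "\<exists>N. \<forall>n\<ge>N. measure M (\<Inter>i. A i) \<le> (1/2)^n"
        by (intro exI allI impI order_trans[OF finite_measure_mono m]) auto
    qed
    then have "(\<Inter>i. A i) \<in> null_sets M"
      by (intro null_setsI) (simp_all add: emeasure_eq_measure order_antisym)
    then have "AE x in M. x \<notin> (\<Inter>i. A i)" by (rule AE_not_in)
    moreover have "AE x in M. \<forall>i. x \<notin> A i \<longrightarrow> (\<forall>\<^sub>F n in sequentially. \<bar>X n x\<bar> \<le> c)"
      using ae by (intro AE_all_countable[THEN iffD2] allI)
    ultimately show ?thesis by eventually_elim blast
  qed
  then have "AE x in M. \<forall>\<^sub>F n in sequentially. \<bar>X n x\<bar> \<le> 1 / real (Suc j)" for j by simp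
  then have "AE x in M. \<forall>j::nat. \<forall>\<^sub>F n in sequentially. \<bar>X n x\<bar> \<le> 1 / real (Suc j)"
    by (intro AE_all_countable[THEN iffD2] allI)
  then show ?thesis
  proof eventually_elim
    case (elim x)
    show ?case
      unfolding tendsto_iff
    proof (intro allI impI)
      fix r :: real assume "0 < r"
      then obtain j :: nat where j: "1 / real (Suc j) < r" using nat_approx_posE by auto
      from elim have "\<forall>\<^sub>F n in sequentially. \<bar>X n x\<bar> \<le> 1 / real (Suc j)" by blast
      then show "\<forall>\<^sub>F n in sequentially. dist (X n x) 0 < r"
        by eventually_elim (use j in simp)
    qed
  qed
qed

text \<open>This is the maximum of 0 and of the sums of \<open>f\<close> over the first
  \<open>k\<close> orbit points, for \<open>k\<close> up to \<open>n\<close>. The recursion is the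
  form in which Garsia's argument uses it.\<close>

primrec max_sum :: "('a \<Rightarrow> 'a) \<Rightarrow> ('a \<Rightarrow> real) \<Rightarrow> nat \<Rightarrow> 'a \<Rightarrow> real" where
  "max_sum T f 0 x = 0"
| "max_sum T f (Suc n) x = max 0 (f x + max_sum T f n (T x))"

lemma max_sum_nonneg: "0 \<le> max_sum T f n x"
  by (cases n) auto

lemma max_sum_mono: "max_sum T f n x \<le> max_sum T f (Suc n) x"
proof (induction n arbitrary: x)
  case (Suc n)
  show ?case using Suc[of "T x"] by (auto simp: max_def simp del: max_sum.simps(2) simp: max_sum.simps(2)[of T f n x] max_sum.simps(2)[of T f "Suc n" x])
qed simp

lemma sum_le_max_sum:
  assumes "k \<le> n" shows "(\<Sum>i<k. f ((T ^^ i) x)) \<le> max_sum T f n x"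
  using assms
proof (induction n arbitrary: k x)
  case (Suc n)
  show ?case
  proof (cases k)
    case (Suc k')
    have "(\<Sum>i<k. f ((T ^^ i) x)) = f x + (\<Sum>i<k'. f ((T ^^ i) (T x)))"
      unfolding Suc by (subst sum.lessThan_Suc_shift) (simp add: funpow_swap1)
    also have "\<dots> \<le> f x + max_sum T f n (T x)"
      using Suc.IH[of k' "T x"] Suc Suc.prems by simp
    also have "\<dots> \<le> max_sum T f (Suc n) x" by simp
    finally show ?thesis .
  qed (simp add: max_sum_nonneg del: max_sum.simps)
qed simp

section \<open>Time averages of a measure-preserving map\<close>

locale measure_preserving_system = prob_space M for M :: "'a measure" +
  fixes T :: "'a \<Rightarrow> 'a"
  assumes T_measurable [measurable]: "T \<in> measurable M M"
    and distr_T: "distr M M T = M"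
begin

lemma integrable_T: "integrable M f \<Longrightarrow> integrable M (\<lambda>x. f (T x))" for f :: "'a \<Rightarrow> real"
  using integrable_distr[OF T_measurable, of f] distr_T by simp

lemma integral_T: "f \<in> borel_measurable M \<Longrightarrow> (\<integral>x. f (T x) \<partial>M) = (\<integral>x. f x \<partial>M)" for f :: "'a \<Rightarrow> real"
  using integral_distr[OF T_measurable, of f] distr_T by simp

lemma max_sum_integrable:
  fixes f :: "'a \<Rightarrow> real"
  assumes f: "integrable M f" shows "integrable M (max_sum T f n)"
proof (induction n)
  case (Suc n)
  show ?case using integrable_T[OF Suc] f by simp
qed simp

text \<open>Garsia's argument: where \<open>max_sum\<close> is positive, it is at most \<open>f\<close> plus its shift.\<close>

lemma maximal_ergodic_max_sum:
  fixes f :: "'a \<Rightarrow> real"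
  assumes f: "integrable M f"
  shows "0 \<le> (\<integral>x. indicator {x\<in>space M. 0 < max_sum T f n x} x * f x \<partial>M)"
proof (cases n)
  case (Suc n')
  let ?E = "{x\<in>space M. 0 < max_sum T f n x}"
  have i: "integrable M (max_sum T f n)" by (rule max_sum_integrable[OF f])
  have [measurable]: "max_sum T f n \<in> borel_measurable M" using i by auto
  \<comment> \<open>By invariance a function minus its shift integrates to 0. Off \<open>?E\<close>
    the maximum is 0 and its shift is nonnegative, so the bound by the indicator term holds there as
    well.\<close>
  have "0 = (\<integral>x. max_sum T f n x - max_sum T f n (T x) \<partial>M)"
    using i integrable_T[OF i] integral_T[of "max_sum T f n"] by simp
  also have "\<dots> \<le> (\<integral>x. indicator ?E x * f x \<partial>M)"
  proof (rule integral_mono)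
    show "integrable M (\<lambda>x. indicator ?E x * f x)"
      using integrable_mult_indicator[OF _ f, of ?E] by simp
    fix x assume x: "x \<in> space M"
    show "max_sum T f n x - max_sum T f n (T x) \<le> indicator ?E x * f x"
    proof (cases "x \<in> ?E")
      case True
      then have "max_sum T f n x = f x + max_sum T f n' (T x)" unfolding Suc by (auto simp: max_def split: if_splits)
      moreover have "max_sum T f n' (T x) \<le> max_sum T f n (T x)" unfolding Suc by (rule max_sum_mono)
      ultimately show ?thesis using True by simp
    next
      case False
      then show ?thesis using x max_sum_nonneg[of T f n "T x"] by simp
    qed
  qed (use i integrable_T[OF i] in auto)
  finally show ?thesis .
qed simp

text \<open>Garsia's inequality for the centred function gives a Markov-type estimate at each
  horizon; the sets increase with the horizon, so one exceptional set serves all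
  \<open>N\<close>.\<close>

lemma maximal_ergodic:
  fixes g :: "'a \<Rightarrow> real"
  assumes g: "integrable M g" and nn: "\<And>x. 0 \<le> g x" and c: "0 < c"
  shows "\<exists>A\<in>sets M. measure M A \<le> (\<integral>x. g x \<partial>M) / c \<and>
           (\<forall>x\<in>space M - A. \<forall>N. (\<Sum>k=1..N. g ((T ^^ k) x)) \<le> c * real N)"
proof -
  \<comment> \<open>\<open>g\<close> is composed with \<open>T\<close> because the orbit sums start
    at \<open>k = 1\<close>, while \<open>sum_le_max_sum\<close> starts at the point itself.\<close>
  define f where "f = (\<lambda>x. g (T x) - c)"
  have gT: "integrable M (\<lambda>x. g (T x))" by (rule integrable_T[OF g])
  have [measurable]: "g \<in> borel_measurable M" using g by auto
  have f: "integrable M f" unfolding f_def using gT by simp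
  have [measurable]: "max_sum T f n \<in> borel_measurable M" for n using max_sum_integrable[OF f] by auto
  define E where "E n = {x\<in>space M. 0 < max_sum T f n x}" for n
  have E[measurable]: "E n \<in> sets M" for n unfolding E_def by measurable
  have bound: "measure M (E n) \<le> (\<integral>x. g x \<partial>M) / c" for n
  proof -
    have int_E: "integrable M (indicator (E n) :: 'a \<Rightarrow> real)"
      by (rule integrable_real_indicator) (auto simp: emeasure_eq_measure)
    have "0 \<le> (\<integral>x. indicator (E n) x * f x \<partial>M)"
      unfolding E_def by (rule maximal_ergodic_max_sum[OF f])
    also have "\<dots> \<le> (\<integral>x. g (T x) - c * indicator (E n) x \<partial>M)"
    proof (rule integral_mono)
      show "integrable M (\<lambda>x. indicator (E n) x * f x)" using integrable_mult_indicator[OF E f, of n] by simp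
      show "integrable M (\<lambda>x. g (T x) - c * indicator (E n) x)"
        by (intro Bochner_Integration.integrable_diff gT integrable_mult_right int_E)
    qed (use nn in \<open>auto simp: f_def indicator_def\<close>)
    also have "\<dots> = (\<integral>x. g x \<partial>M) - c * measure M (E n)"
      using gT integral_T[of g] int_E by simp
    finally have "c * measure M (E n) \<le> (\<integral>x. g x \<partial>M)" by simp
    then show ?thesis using c by (simp add: pos_le_divide_eq mult.commute)
  qed
  have inc: "incseq E"
    unfolding E_def by (rule incseq_SucI) (use max_sum_mono[of T f] order.strict_trans2 in blast)
  have "(\<lambda>n. measure M (E n)) \<longlonglongrightarrow> measure M (\<Union>n. E n)"
    by (rule finite_Lim_measure_incseq) (use inc in auto)
  then have "measure M (\<Union>n. E n) \<le> (\<integral>x. g x \<partial>M) / c"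
    by (rule LIMSEQ_le_const2) (use bound in auto)
  moreover have "(\<Sum>k=1..N. g ((T ^^ k) x)) \<le> c * real N" if x: "x \<in> space M - (\<Union>n. E n)" for x N
  proof -
    have "(\<Sum>k=1..N. g ((T ^^ k) x)) - c * real N = (\<Sum>i<N. f ((T ^^ i) x))"
      by (simp add: f_def sum_subtractf sum.atLeast1_atMost_eq mult.commute)
    also have "\<dots> \<le> max_sum T f N x" by (rule sum_le_max_sum) simp
    also have "\<dots> \<le> 0" using x unfolding E_def by (auto simp: not_less)
    finally show ?thesis by simp
  qed
  ultimately show ?thesis by (intro bexI[of _ "\<Union>n. E n"]) auto
qed

text \<open>A Banach principle: convergence to 0 survives errors bounded by time averages of a
  function of small integral. \<open>X\<close> need not consist of time averages, and the vanishing
  part \<open>y\<close> is chosen point by point, so its measurability never comes up.\<close>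

lemma ergodic_approximation:
  fixes X :: "nat \<Rightarrow> 'a \<Rightarrow> real"
  assumes approx: "\<And>e. 0 < e \<Longrightarrow> \<exists>g. integrable M g \<and> (\<forall>x. 0 \<le> g x) \<and> (\<integral>x. g x \<partial>M) \<le> e \<and>
      (AE x in M. \<exists>y. y \<longlonglongrightarrow> 0 \<and> (\<forall>N\<ge>1. \<bar>X N x\<bar> \<le> y N + (\<Sum>k=1..N. g ((T ^^ k) x)) / real N))"
  shows "AE x in M. (\<lambda>N. X N x) \<longlonglongrightarrow> 0"
proof (rule AE_LIMSEQ_zero_if_small_exceptional_sets)
  fix c e :: real assume c: "0 < c" and e: "0 < e"
  \<comment> \<open>The tolerance \<open>c\<close> is split into halves, one for \<open>y\<close>
    and one for the averages of \<open>g\<close>; the maximal inequality at level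
    \<open>c / 2\<close> turns the integral bound \<open>c / 2 * e\<close> into measure at most
    \<open>e\<close>.\<close>
  obtain g where g: "integrable M g" "\<And>x. 0 \<le> g x" "(\<integral>x. g x \<partial>M) \<le> c / 2 * e"
    and ae: "AE x in M. \<exists>y. y \<longlonglongrightarrow> 0 \<and> (\<forall>N\<ge>1. \<bar>X N x\<bar> \<le> y N + (\<Sum>k=1..N. g ((T ^^ k) x)) / real N)"
    using approx[of "c / 2 * e"] c e by auto
  obtain A where A: "A \<in> sets M" "measure M A \<le> (\<integral>x. g x \<partial>M) / (c / 2)"
    and le: "\<And>x N. x \<in> space M - A \<Longrightarrow> (\<Sum>k=1..N. g ((T ^^ k) x)) \<le> c / 2 * real N"
    using maximal_ergodic[OF g(1,2), of "c / 2"] c by auto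
  have "(\<integral>x. g x \<partial>M) / (c / 2) \<le> e" using g(3) c by (subst pos_divide_le_eq) (auto simp: mult.commute)
  then have m: "measure M A \<le> e" using A(2) by linarith
  have "AE x in M. x \<notin> A \<longrightarrow> (\<forall>\<^sub>F N in sequentially. \<bar>X N x\<bar> \<le> c)"
    using ae AE_space
  proof eventually_elim
    case (elim x)
    then obtain y where y: "y \<longlonglongrightarrow> 0" "\<And>N. N \<ge> 1 \<Longrightarrow> \<bar>X N x\<bar> \<le> y N + (\<Sum>k=1..N. g ((T ^^ k) x)) / real N"
      by auto
    have "\<forall>\<^sub>F N in sequentially. y N < c / 2" using order_tendstoD(2)[OF y(1), of "c / 2"] c by simp
    then show ?case
      using eventually_ge_at_top[of 1]
    proof (intro impI, eventually_elim)
      fix N :: nat assume "x \<notin> A" "y N < c / 2" "1 \<le> N"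
      have "(\<Sum>k=1..N. g ((T ^^ k) x)) / real N \<le> c / 2"
        using le[of x N] elim(2) \<open>x \<notin> A\<close> \<open>1 \<le> N\<close> by (subst pos_divide_le_eq) auto
      with y(2)[OF \<open>1 \<le> N\<close>] \<open>y N < c / 2\<close> show "\<bar>X N x\<bar> \<le> c" by linarith
    qed
  qed
  with A(1) m show "\<exists>A\<in>sets M. measure M A \<le> e \<and> (AE x in M. x \<notin> A \<longrightarrow> (\<forall>\<^sub>F N in sequentially. \<bar>X N x\<bar> \<le> c))"
    by blast
qed

text \<open>The averaged function changes with time. From time \<open>m\<close> on it is replaced by
  the supremum of the tail, which by domination has small integral for large \<open>m\<close>; the
  finitely many earlier terms vanish after division by \<open>N\<close>.\<close>

lemma maker_ergodic:
  fixes D :: "nat \<Rightarrow> 'a \<Rightarrow> real"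
  assumes D[measurable]: "\<And>k. D k \<in> borel_measurable M"
    and H: "integrable M H" and nn: "\<And>k x. 0 \<le> D k x" and le: "\<And>k x. D k x \<le> H x"
    and lim: "AE x in M. (\<lambda>k. D k x) \<longlonglongrightarrow> 0"
  shows "AE x in M. (\<lambda>N. (\<Sum>k=1..N. D k ((T ^^ k) x)) / real N) \<longlonglongrightarrow> 0"
proof (rule ergodic_approximation)
  fix e :: real assume e: "0 < e"
  define s where "s m x = (SUP k\<in>{m..}. D k x)" for m x
  have bdd: "bdd_above ((\<lambda>k. D k x) ` {m..})" for m x using le by (intro bdd_aboveI[of _ "H x"]) auto
  have D_le: "D k x \<le> s m x" if "m \<le> k" for k m x
    unfolding s_def by (rule cSUP_upper) (use that bdd in auto)
  have s_nn: "0 \<le> s m x" for m x using D_le[of m m x] nn[of m x] by simp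
  have s_le: "s m x \<le> H x" for m x unfolding s_def by (rule cSUP_least) (use le in auto)
  have [measurable]: "s m \<in> borel_measurable M" for m
    unfolding s_def by (rule borel_measurable_cSUP) (use bdd in auto)
  have s_int: "integrable M (s m)" for m
    by (rule Bochner_Integration.integrable_bound[OF H]) (use s_nn s_le in \<open>auto intro!: AE_I2 order_trans[OF s_le]\<close>)
  have "(\<lambda>m. \<integral>x. s m x \<partial>M) \<longlonglongrightarrow> (\<integral>x. 0 \<partial>M)"
  proof (rule integral_dominated_convergence[OF _ _ H])
    show "AE x in M. (\<lambda>m. s m x) \<longlonglongrightarrow> 0"
      using lim
    proof eventually_elim
      case (elim x)
      show ?case
      proof (rule LIMSEQ_I)
        fix r :: real assume r: "0 < r"
        obtain m0 where m0: "\<And>k. k \<ge> m0 \<Longrightarrow> \<bar>D k x\<bar> < r / 2" using LIMSEQ_D[OF elim, of "r/2"] r by auto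
        have "s m x \<le> r / 2" if "m \<ge> m0" for m
          unfolding s_def
        proof (rule cSUP_least)
          fix k assume "k \<in> {m..}"
          then have "\<bar>D k x\<bar> < r / 2" by (intro m0 order_trans[OF that]) auto
          then show "D k x \<le> r / 2" by linarith
        qed simp
        then have "norm (s m x - 0) < r" if "m \<ge> m0" for m
          using r s_nn[of m x] that by fastforce
        then show "\<exists>no. \<forall>n\<ge>no. norm (s n x - 0) < r" by blast
      qed
    qed
  qed (use s_nn s_le in \<open>auto intro!: AE_I2\<close>)
  then have "\<forall>\<^sub>F m in sequentially. (\<integral>x. s m x \<partial>M) < e" using e by (auto dest: order_tendstoD(2))
  then obtain m where m: "(\<integral>x. s m x \<partial>M) < e" by (auto simp: eventually_sequentially)
  show "\<exists>g. integrable M g \<and> (\<forall>x. 0 \<le> g x) \<and> (\<integral>x. g x \<partial>M) \<le> e \<and>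
      (AE x in M. \<exists>y. y \<longlonglongrightarrow> 0 \<and> (\<forall>N\<ge>1. \<bar>(\<Sum>k=1..N. D k ((T ^^ k) x)) / real N\<bar> \<le> y N + (\<Sum>k=1..N. g ((T ^^ k) x)) / real N))"
  proof (intro exI[of _ "s m"] conjI allI AE_I2)
    fix x
    \<comment> \<open>A bound for the total of the terms with \<open>k\<close> at most
      \<open>m\<close> that does not depend on \<open>N\<close>.\<close>
    define c where "c = (\<Sum>k\<in>{..m}. H ((T ^^ k) x))"
    have "\<bar>(\<Sum>k=1..N. D k ((T ^^ k) x)) / real N\<bar> \<le> c / real N + (\<Sum>k=1..N. s m ((T ^^ k) x)) / real N" if "N \<ge> 1" for N
    proof -
      have H_nn: "0 \<le> H z" for z using order_trans[OF nn le] .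
      have "(\<Sum>k=1..N. D k ((T ^^ k) x)) \<le> (\<Sum>k=1..N. s m ((T ^^ k) x) + (if k \<le> m then H ((T ^^ k) x) else 0))"
        using D_le[of m] le s_nn by (intro sum_mono) (auto simp: not_le intro: add_increasing)
      also have "\<dots> \<le> (\<Sum>k=1..N. s m ((T ^^ k) x)) + c"
      proof -
        have "(\<Sum>k=1..N. (if k \<le> m then H ((T ^^ k) x) else 0)) = (\<Sum>k\<in>{1..N} \<inter> {..m}. H ((T ^^ k) x))"
          by (subst sum.inter_restrict) (auto intro!: sum.cong)
        also have "\<dots> \<le> c" unfolding c_def by (rule sum_mono2) (auto simp: H_nn)
        finally show ?thesis by (simp add: sum.distrib)
      qed
      finally have "(\<Sum>k=1..N. D k ((T ^^ k) x)) / real N \<le> ((\<Sum>k=1..N. s m ((T ^^ k) x)) + c) / real N"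
        by (rule divide_right_mono) simp
      then show ?thesis by (simp add: add_divide_distrib sum_nonneg nn)
    qed
    moreover have "(\<lambda>N. c / real N) \<longlonglongrightarrow> 0" by (rule lim_const_over_n)
    ultimately show "\<exists>y. y \<longlonglongrightarrow> 0 \<and> (\<forall>N\<ge>1. \<bar>(\<Sum>k=1..N. D k ((T ^^ k) x)) / real N\<bar> \<le> y N + (\<Sum>k=1..N. s m ((T ^^ k) x)) / real N)"
      by (intro exI[of _ "\<lambda>N. c / real N"]) auto
  qed (use s_int s_nn m in auto)
qed

end

text \<open>Orthogonality makes the second moment of the \<open>N\<close>-th sum at most
  \<open>C * C * N\<close>, so the squared averages at \<open>N = n^2\<close> have integrals of
  order \<open>1 / n^2\<close> and are almost surely summable. Only mixed second moments enter,
  which is what the shifted increments below can supply.\<close>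

lemma (in prob_space) SLLN_bounded_orthogonal:
  fixes X :: "nat \<Rightarrow> 'a \<Rightarrow> real"
  assumes X[measurable]: "\<And>k. X k \<in> borel_measurable M"
    and bdd: "AE x in M. \<forall>k. \<bar>X k x\<bar> \<le> C"
    and orth: "\<And>i k. 1 \<le> i \<Longrightarrow> i < k \<Longrightarrow> (\<integral>x. X i x * X k x \<partial>M) = 0"
  shows "AE x in M. (\<lambda>N. (\<Sum>k=1..N. X k x) / real N) \<longlonglongrightarrow> 0"
proof -
  have bd: "AE x in M. \<bar>X k x\<bar> \<le> C" for k using bdd by eventually_elim auto
  have C: "0 \<le> C"
  proof -
    have "AE x in M. 0 \<le> C" using bd[of 0] by eventually_elim auto
    then show ?thesis by (simp add: AE_const)
  qed
  have int: "integrable M (\<lambda>x. X i x * X k x)" for i k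
  proof (rule integrable_const_bound[of _ "C * C"])
    show "AE x in M. norm (X i x * X k x) \<le> C * C"
      using bd[of i] bd[of k] by eventually_elim (auto simp: abs_mult intro!: mult_mono C)
  qed simp
  \<comment> \<open>Chebyshev along the squares; boundedness fills the gaps between consecutive squares.\<close>
  define S where "S N x = (\<Sum>k=1..N. X k x)" for N x
  have [measurable]: "S N \<in> borel_measurable M" for N unfolding S_def by measurable
  have S_int: "integrable M (\<lambda>x. (S N x)\<^sup>2)" for N
    unfolding S_def power2_eq_square sum_product by (intro Bochner_Integration.integrable_sum int)
  have S_var: "(\<integral>x. (S N x)\<^sup>2 \<partial>M) \<le> C * C * real N" for N
  proof -
    have "(\<integral>x. (S N x)\<^sup>2 \<partial>M) = (\<Sum>i=1..N. \<Sum>k=1..N. \<integral>x. X i x * X k x \<partial>M)"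
      unfolding S_def power2_eq_square sum_product
      by (simp add: Bochner_Integration.integral_sum Bochner_Integration.integrable_sum int)
    also have "\<dots> = (\<Sum>i=1..N. \<Sum>k=1..N. if k = i then \<integral>x. X i x * X i x \<partial>M else 0)"
    proof (intro sum.cong refl)
      fix i k assume "i \<in> {1..N}" "k \<in> {1..N}"
      then show "(\<integral>x. X i x * X k x \<partial>M) = (if k = i then \<integral>x. X i x * X i x \<partial>M else 0)"
        using orth[of i k] orth[of k i] by (cases i k rule: linorder_cases) (auto simp: mult.commute)
    qed
    also have "\<dots> = (\<Sum>i=1..N. \<integral>x. X i x * X i x \<partial>M)" by simp
    also have "\<dots> \<le> (\<Sum>i=1..N. C * C)"
    proof (rule sum_mono)
      fix i
      have "(\<integral>x. X i x * X i x \<partial>M) \<le> (\<integral>x. C * C \<partial>M)"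
      proof (rule integral_mono_AE[OF int])
        show "AE x in M. X i x * X i x \<le> C * C" using bd[of i]
          by eventually_elim (metis abs_ge_zero abs_mult_self_eq mult_mono C)
      qed simp
      then show "(\<integral>x. X i x * X i x \<partial>M) \<le> C * C" by (simp add: prob_space)
    qed
    finally show ?thesis by (simp add: mult.commute)
  qed
  have "AE x in M. summable (\<lambda>n. (S (Suc n ^ 2) x / real (Suc n ^ 2))\<^sup>2)"
  proof (rule AE_summable)
    show "integrable M (\<lambda>x. (S (Suc n ^ 2) x / real (Suc n ^ 2))\<^sup>2)" for n
      unfolding power_divide using S_int by simp
    show "summable (\<lambda>n. \<integral>x. (S (Suc n ^ 2) x / real (Suc n ^ 2))\<^sup>2 \<partial>M)"
    proof (rule summable_comparison_test'[where N=0])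
      show "summable (\<lambda>n. C * C * inverse (real (Suc n) ^ 2))"
        using inverse_power_summable[of 2, where ?'a=real]
        by (intro summable_mult) (subst summable_Suc_iff[of "\<lambda>n. inverse (real n ^ 2)"], simp)
      fix n :: nat
      have "(\<integral>x. (S (Suc n ^ 2) x / real (Suc n ^ 2))\<^sup>2 \<partial>M) = (\<integral>x. (S (Suc n ^ 2) x)\<^sup>2 \<partial>M) / (real (Suc n ^ 2))\<^sup>2"
        unfolding power_divide by simp
      also have "\<dots> \<le> C * C * real (Suc n ^ 2) / (real (Suc n ^ 2))\<^sup>2"
        by (rule divide_right_mono[OF S_var]) simp
      also have "\<dots> = C * C * inverse (real (Suc n) ^ 2)"
      proof -
        have "b / b\<^sup>2 = inverse b" for b :: real by (cases "b = 0") (simp_all add: power2_eq_square divide_inverse)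
        from this[of "real (Suc n ^ 2)"] show ?thesis
          by (simp only: times_divide_eq_right[symmetric] of_nat_power)
      qed
      finally show "norm (\<integral>x. (S (Suc n ^ 2) x / real (Suc n ^ 2))\<^sup>2 \<partial>M) \<le> C * C * inverse (real (Suc n) ^ 2)"
        by simp
    qed
  qed simp
  with bdd show ?thesis
  proof eventually_elim
    case (elim x)
    have sq: "(\<lambda>n. S (n ^ 2) x / real (n ^ 2)) \<longlonglongrightarrow> 0"
    proof (rule LIMSEQ_imp_Suc)
      have "(\<lambda>n. (S (Suc n ^ 2) x / real (Suc n ^ 2))\<^sup>2) \<longlonglongrightarrow> 0"
        by (rule summable_LIMSEQ_zero[OF elim(2)])
      then have "(\<lambda>n. sqrt ((S (Suc n ^ 2) x / real (Suc n ^ 2))\<^sup>2)) \<longlonglongrightarrow> sqrt 0"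
        by (rule tendsto_real_sqrt)
      then show "(\<lambda>n. S (Suc n ^ 2) x / real (Suc n ^ 2)) \<longlonglongrightarrow> 0"
        by (simp only: real_sqrt_abs real_sqrt_zero tendsto_rabs_zero_iff)
    qed
    \<comment> \<open>With \<open>n = r N\<close>, at most \<open>2 * n\<close> terms of size
      \<open>C\<close> lie after the last square, and \<open>N\<close> is at least
      \<open>n^2\<close>; this is the error \<open>2 * C * (1 / n)\<close>.\<close>
    define r where "r N = floor_sqrt N" for N
    have r_lim: "filterlim r at_top sequentially"
      unfolding filterlim_at_top
    proof
      fix Z :: nat
      show "\<forall>\<^sub>F N in sequentially. Z \<le> r N"
        unfolding r_def using eventually_ge_at_top[of "Z ^ 2"]
        by eventually_elim (simp add: le_floor_sqrt_iff)
    qed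
    have "(\<lambda>N. \<bar>S (r N ^ 2) x / real (r N ^ 2)\<bar> + 2 * C * (1 / real (r N))) \<longlonglongrightarrow> 0 + 2 * C * 0"
    proof (intro tendsto_add tendsto_mult tendsto_const)
      show "(\<lambda>N. \<bar>S (r N ^ 2) x / real (r N ^ 2)\<bar>) \<longlonglongrightarrow> 0"
        using filterlim_compose[OF tendsto_rabs_zero[OF sq] r_lim] by simp
      show "(\<lambda>N. 1 / real (r N)) \<longlonglongrightarrow> 0"
        using filterlim_compose[OF lim_1_over_n r_lim] by simp
    qed
    then have "(\<lambda>N. \<bar>S (r N ^ 2) x / real (r N ^ 2)\<bar> + 2 * C * (1 / real (r N))) \<longlonglongrightarrow> 0" by simp
    then show ?case
    proof (rule Lim_null_comparison[rotated])
      show "\<forall>\<^sub>F N in sequentially. norm ((\<Sum>k=1..N. X k x) / real N)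
          \<le> \<bar>S (r N ^ 2) x / real (r N ^ 2)\<bar> + 2 * C * (1 / real (r N))"
        using eventually_ge_at_top[of 1]
      proof eventually_elim
        fix N :: nat assume N: "1 \<le> N"
        define n where "n = r N"
        have n2: "n ^ 2 \<le> N" "N < (Suc n) ^ 2" unfolding n_def r_def
          by (simp_all add: Suc_floor_sqrt_power2_gt)
        have n1: "1 \<le> n" unfolding n_def r_def using N by (simp add: le_floor_sqrt_iff)
        have "S N x = S (n ^ 2) x + (\<Sum>k\<in>{n^2<..N}. X k x)"
        proof -
          have "{1..N} = {1..n^2} \<union> {n^2<..N}" using n2 by auto
          then show ?thesis unfolding S_def by (simp only:) (rule sum.union_disjoint, auto)
        qed
        moreover have "\<bar>\<Sum>k\<in>{n^2<..N}. X k x\<bar> \<le> real (2 * n) * C"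
        proof -
          have "\<bar>\<Sum>k\<in>{n^2<..N}. X k x\<bar> \<le> (\<Sum>k\<in>{n^2<..N}. C)"
            using elim(1) by (intro order_trans[OF sum_abs] sum_mono) auto
          also have "\<dots> = real (N - n ^ 2) * C" by simp
          also have "\<dots> \<le> real (2 * n) * C"
          proof (intro mult_right_mono C of_nat_mono)
            show "N - n ^ 2 \<le> 2 * n" using n2 by (simp add: power2_eq_square)
          qed
          finally show ?thesis .
        qed
        ultimately have "\<bar>S N x\<bar> \<le> \<bar>S (n ^ 2) x\<bar> + real (2 * n) * C" by linarith
        then have "\<bar>S N x\<bar> / real N \<le> (\<bar>S (n ^ 2) x\<bar> + real (2 * n) * C) / real N"
          by (rule divide_right_mono) simp
        also have "\<dots> \<le> (\<bar>S (n ^ 2) x\<bar> + real (2 * n) * C) / real (n ^ 2)"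
        proof (rule divide_left_mono)
          show "real (n ^ 2) \<le> real N" using n2(1) by (rule of_nat_mono)
        qed (use n1 N C in auto)
        also have "\<dots> = \<bar>S (n ^ 2) x / real (n ^ 2)\<bar> + 2 * C * (1 / real n)"
          by (simp add: add_divide_distrib power2_eq_square)
        finally show "norm ((\<Sum>k=1..N. X k x) / real N)
          \<le> \<bar>S (r N ^ 2) x / real (r N ^ 2)\<bar> + 2 * C * (1 / real (r N))"
          by (simp add: n_def S_def)
      qed
    qed
  qed
qed

section \<open>Convergence of conditional expectations\<close>

context prob_space
begin

lemma finite_measure_subalgebraI: "subalgebra M G \<Longrightarrow> finite_measure_subalgebra M G"
  by (intro finite_measure_subalgebra.intro finite_measure_subalgebra_axioms.intro) unfold_locales

lemma L1_distance_le_L2: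
  fixes f :: "'a \<Rightarrow> real"
  assumes f: "integrable M f" and f2: "integrable M (\<lambda>x. (f x)\<^sup>2)"
  shows "(\<integral>x. \<bar>f x\<bar> \<partial>M) \<le> sqrt (\<integral>x. (f x)\<^sup>2 \<partial>M)"
proof -
  have "0 \<le> variance (\<lambda>x. \<bar>f x\<bar>)" by (rule variance_positive)
  also have "\<dots> = (\<integral>x. (f x)\<^sup>2 \<partial>M) - (\<integral>x. \<bar>f x\<bar> \<partial>M)\<^sup>2"
    using variance_eq[of "\<lambda>x. \<bar>f x\<bar>"] f f2 by simp
  finally show ?thesis by (intro real_le_rsqrt) simp
qed

lemma bounded_integrable:
  fixes f :: "'a \<Rightarrow> real"
  shows "f \<in> borel_measurable M \<Longrightarrow> AE x in M. \<bar>f x\<bar> \<le> C \<Longrightarrow> integrable M f"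
  by (rule integrable_const_bound[of _ C]) auto

text \<open>A subsequence with L1 gaps \<open>(1/2)^j\<close> has almost surely summable increments,
  hence converges; the Cauchy property carries the limit over to the whole sequence. The limit is
  given as the \<open>lim\<close> of that subsequence so that its measurability for a smaller field
  can be read off later.\<close>

lemma bounded_L1_Cauchy:
  fixes X :: "nat \<Rightarrow> 'a \<Rightarrow> real"
  assumes X[measurable]: "\<And>n. X n \<in> borel_measurable M"
    and bdd: "\<And>n. AE x in M. \<bar>X n x\<bar> \<le> C"
    and Cauchy: "\<And>e. 0 < e \<Longrightarrow> \<exists>N. \<forall>n\<ge>N. \<forall>m\<ge>N. (\<integral>x. \<bar>X n x - X m x\<bar> \<partial>M) \<le> e"
  shows "\<exists>r::nat \<Rightarrow> nat. strict_mono r \<and> (AE x in M. \<bar>lim (\<lambda>n. X (r n) x)\<bar> \<le> C) \<and>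
    (\<lambda>n. \<integral>x. \<bar>X n x - lim (\<lambda>k. X (r k) x)\<bar> \<partial>M) \<longlonglongrightarrow> 0"
proof -
  have Xint: "integrable M (X n)" for n by (rule bounded_integrable[OF X bdd])
  have "\<exists>N. \<forall>n\<ge>N. \<forall>m\<ge>N. (\<integral>x. \<bar>X n x - X m x\<bar> \<partial>M) \<le> (1/2)^j" for j :: nat
    by (rule Cauchy) simp
  then obtain N where N: "\<And>j n m. n \<ge> N j \<Longrightarrow> m \<ge> N j \<Longrightarrow> (\<integral>x. \<bar>X n x - X m x\<bar> \<partial>M) \<le> (1/2)^j"
    by metis
  \<comment> \<open>Summing the thresholds makes the index strictly increasing and still at least
    \<open>N j\<close>.\<close>
  define r where "r j = (\<Sum>i\<le>j. Suc (N i))" for j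
  have r: "strict_mono r" unfolding r_def strict_mono_Suc_iff by simp
  have r_N: "N j \<le> r j" for j unfolding r_def
    using member_le_sum[of j "{..j}" "\<lambda>i. Suc (N i)"] by simp
  have "AE x in M. summable (\<lambda>j. \<bar>X (r (Suc j)) x - X (r j) x\<bar>)"
  proof (rule AE_summable)
    show "summable (\<lambda>j. \<integral>x. \<bar>X (r (Suc j)) x - X (r j) x\<bar> \<partial>M)"
    proof (rule summable_comparison_test'[where N=0])
      show "summable (\<lambda>j. (1/2::real)^j)" by (rule summable_geometric) simp
      fix j
      have "r j < r (Suc j)" using r by (simp add: strict_mono_Suc_iff)
      then show "norm (\<integral>x. \<bar>X (r (Suc j)) x - X (r j) x\<bar> \<partial>M) \<le> (1/2)^j"
        using N[of j "r (Suc j)" "r j"] r_N[of j] by simp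
    qed
  qed (use Xint in auto)
  then have conv: "AE x in M. convergent (\<lambda>j. X (r j) x)"
  proof eventually_elim
    case (elim x)
    have "summable (\<lambda>j. X (r (Suc j)) x - X (r j) x)" by (rule summable_rabs_cancel[OF elim])
    then have "convergent (\<lambda>n. \<Sum>j<n. X (r (Suc j)) x - X (r j) x)" by (simp add: summable_iff_convergent)
    then have "convergent (\<lambda>n. X (r n) x - X (r 0) x)" by (subst (asm) sum_lessThan_telescope)
    then have "convergent (\<lambda>n. (X (r n) x - X (r 0) x) + X (r 0) x)" by (intro convergent_add convergent_const)
    then show ?case by simp
  qed
  define g where "g x = lim (\<lambda>k. X (r k) x)" for x
  have [measurable]: "g \<in> borel_measurable M" unfolding g_def by measurable
  have allbdd: "AE x in M. \<forall>n. \<bar>X n x\<bar> \<le> C" using bdd by (intro AE_all_countable[THEN iffD2] allI)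
  have lim: "AE x in M. (\<lambda>k. X (r k) x) \<longlonglongrightarrow> g x"
    using conv by eventually_elim (simp add: g_def convergent_LIMSEQ_iff)
  have g_bdd: "AE x in M. \<bar>g x\<bar> \<le> C"
    using lim allbdd
  proof eventually_elim
    case (elim x)
    from elim(1) have "(\<lambda>k. \<bar>X (r k) x\<bar>) \<longlonglongrightarrow> \<bar>g x\<bar>" by (rule tendsto_rabs)
    then show ?case by (rule LIMSEQ_le_const2) (use elim(2) in auto)
  qed
  have "(\<lambda>n. \<integral>x. \<bar>X n x - g x\<bar> \<partial>M) \<longlonglongrightarrow> 0"
  proof (rule LIMSEQ_I)
    fix e :: real assume e: "0 < e"
    obtain N0 where N0: "\<And>n m. n \<ge> N0 \<Longrightarrow> m \<ge> N0 \<Longrightarrow> (\<integral>x. \<bar>X n x - X m x\<bar> \<partial>M) \<le> e / 2"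
      using Cauchy[of "e/2"] e by auto
    have "(\<integral>x. \<bar>X n x - g x\<bar> \<partial>M) \<le> e / 2" if n: "n \<ge> N0" for n
    proof -
      have "(\<lambda>k. \<integral>x. \<bar>X n x - X (r k) x\<bar> \<partial>M) \<longlonglongrightarrow> (\<integral>x. \<bar>X n x - g x\<bar> \<partial>M)"
      proof (rule integral_dominated_convergence[where w="\<lambda>_. 2 * C"])
        show "AE x in M. (\<lambda>k. \<bar>X n x - X (r k) x\<bar>) \<longlonglongrightarrow> \<bar>X n x - g x\<bar>"
          using lim by eventually_elim (intro tendsto_intros)
        show "AE x in M. norm \<bar>X n x - X (r k) x\<bar> \<le> 2 * C" for k
          using bdd[of n] bdd[of "r k"] by eventually_elim auto
      qed auto
      moreover have "\<exists>K. \<forall>k\<ge>K. (\<integral>x. \<bar>X n x - X (r k) x\<bar> \<partial>M) \<le> e / 2"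
        using N0[OF n] seq_suble[OF r] order_trans by blast
      ultimately show ?thesis by (rule LIMSEQ_le_const2)
    qed
    then have "norm ((\<integral>x. \<bar>X n x - g x\<bar> \<partial>M) - 0) < e" if "n \<ge> N0" for n
      using that e by fastforce
    then show "\<exists>no. \<forall>n\<ge>no. norm ((\<integral>x. \<bar>X n x - g x\<bar> \<partial>M) - 0) < e" by blast
  qed
  then show ?thesis using r g_bdd unfolding g_def by blast
qed

section \<open>L1 and L2 estimates for conditional expectations\<close>

lemma cond_exp_abs_le:
  assumes G: "subalgebra M G" and f: "integrable M f"
  shows "AE x in M. \<bar>real_cond_exp M G f x\<bar> \<le> real_cond_exp M G (\<lambda>x. \<bar>f x\<bar>) x"
proof -
  interpret finite_measure_subalgebra M G by (rule finite_measure_subalgebraI[OF G])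
  have "AE x in M. real_cond_exp M G f x \<le> real_cond_exp M G (\<lambda>x. \<bar>f x\<bar>) x"
    by (rule real_cond_exp_mono) (use f in auto)
  moreover have "AE x in M. real_cond_exp M G (\<lambda>x. - 1 * f x) x \<le> real_cond_exp M G (\<lambda>x. \<bar>f x\<bar>) x"
    by (rule real_cond_exp_mono) (use f in auto)
  moreover have "AE x in M. real_cond_exp M G (\<lambda>x. - 1 * f x) x = - 1 * real_cond_exp M G f x"
    by (rule real_cond_exp_cmult[OF f])
  ultimately show ?thesis by eventually_elim simp
qed

lemma cond_exp_integral_abs_le:
  assumes G: "subalgebra M G" and f: "integrable M f"
  shows "(\<integral>x. \<bar>real_cond_exp M G f x\<bar> \<partial>M) \<le> (\<integral>x. \<bar>f x\<bar> \<partial>M)"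
proof -
  interpret finite_measure_subalgebra M G by (rule finite_measure_subalgebraI[OF G])
  have "(\<integral>x. \<bar>real_cond_exp M G f x\<bar> \<partial>M) \<le> (\<integral>x. real_cond_exp M G (\<lambda>x. \<bar>f x\<bar>) x \<partial>M)"
    by (rule integral_mono_AE[OF _ _ cond_exp_abs_le[OF G f]]) (use f real_cond_exp_int in auto)
  also have "\<dots> = (\<integral>x. \<bar>f x\<bar> \<partial>M)" by (rule real_cond_exp_int(2)) (use f in auto)
  finally show ?thesis .
qed

lemma cond_exp_contraction:
  assumes G: "subalgebra M G" and f: "integrable M f" and g: "integrable M g"
  shows "(\<integral>x. \<bar>real_cond_exp M G f x - real_cond_exp M G g x\<bar> \<partial>M) \<le> (\<integral>x. \<bar>f x - g x\<bar> \<partial>M)"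
proof -
  interpret finite_measure_subalgebra M G by (rule finite_measure_subalgebraI[OF G])
  have "(\<integral>x. \<bar>real_cond_exp M G f x - real_cond_exp M G g x\<bar> \<partial>M) = (\<integral>x. \<bar>real_cond_exp M G (\<lambda>x. f x - g x) x\<bar> \<partial>M)"
    by (rule integral_cong_AE) (use real_cond_exp_diff[OF f g] in auto)
  also have "\<dots> \<le> (\<integral>x. \<bar>f x - g x\<bar> \<partial>M)"
    by (rule cond_exp_integral_abs_le[OF G]) (use f g in auto)
  finally show ?thesis .
qed

lemma cond_exp_bounded:
  assumes G: "subalgebra M G" and f: "integrable M f" and bdd: "AE x in M. \<bar>f x\<bar> \<le> C"
  shows "AE x in M. \<bar>real_cond_exp M G f x\<bar> \<le> C"
proof -
  interpret finite_measure_subalgebra M G by (rule finite_measure_subalgebraI[OF G])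
  have "AE x in M. real_cond_exp M G (\<lambda>x. \<bar>f x\<bar>) x \<le> C"
    by (rule real_cond_exp_le_c) (use f bdd in auto)
  with cond_exp_abs_le[OF G f] show ?thesis by eventually_elim simp
qed

text \<open>The cross term reduces by the tower property: conditioning the finer expectation on
  \<open>G\<close> gives the coarser one, which is itself \<open>G\<close>-measurable.\<close>

lemma cond_exp_pythagoras:
  assumes G: "subalgebra M G" and F: "subalgebra M F" and GF: "subalgebra F G"
    and f: "integrable M f" and bdd: "AE x in M. \<bar>f x\<bar> \<le> C"
  shows "(\<integral>x. (real_cond_exp M F f x - real_cond_exp M G f x)\<^sup>2 \<partial>M) =
    (\<integral>x. (real_cond_exp M F f x)\<^sup>2 \<partial>M) - (\<integral>x. (real_cond_exp M G f x)\<^sup>2 \<partial>M)"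
proof -
  interpret G: finite_measure_subalgebra M G by (rule finite_measure_subalgebraI[OF G])
  interpret F: finite_measure_subalgebra M F by (rule finite_measure_subalgebraI[OF F])
  let ?g = "real_cond_exp M G f" and ?h = "real_cond_exp M F f"
  note bg = cond_exp_bounded[OF G f bdd] and bh = cond_exp_bounded[OF F f bdd]
  have prod_int: "integrable M (\<lambda>x. u x * v x)"
    if [measurable]: "u \<in> borel_measurable M" "v \<in> borel_measurable M"
      and b: "AE x in M. \<bar>u x\<bar> \<le> C" "AE x in M. \<bar>v x\<bar> \<le> C" for u v :: "'a \<Rightarrow> real"
  proof (rule bounded_integrable[of _ "C * C"])
    show "AE x in M. \<bar>u x * v x\<bar> \<le> C * C" using b
      by eventually_elim (auto simp: abs_mult intro!: mult_mono)
  qed simp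
  have "(\<integral>x. ?g x * ?h x \<partial>M) = (\<integral>x. ?g x * real_cond_exp M G ?h x \<partial>M)"
    by (rule G.real_cond_exp_intg(2)[symmetric]) (use bg bh in \<open>simp_all add: prod_int\<close>)
  also have "\<dots> = (\<integral>x. ?g x * ?g x \<partial>M)"
    using G.real_cond_exp_nested_subalg[OF F GF f] by (intro integral_cong_AE) auto
  finally have cross: "(\<integral>x. ?g x * ?h x \<partial>M) = (\<integral>x. ?g x * ?g x \<partial>M)" .
  have hh: "integrable M (\<lambda>x. ?h x * ?h x)" and gh: "integrable M (\<lambda>x. ?g x * ?h x)"
    and gg: "integrable M (\<lambda>x. ?g x * ?g x)"
    by (rule prod_int; use bg bh in simp)+
  have "(\<integral>x. (?h x - ?g x)\<^sup>2 \<partial>M) = (\<integral>x. ?h x * ?h x - 2 * (?g x * ?h x) + ?g x * ?g x \<partial>M)"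
    by (simp add: power2_eq_square algebra_simps)
  also have "\<dots> = (\<integral>x. ?h x * ?h x \<partial>M) - 2 * (\<integral>x. ?g x * ?h x \<partial>M) + (\<integral>x. ?g x * ?g x \<partial>M)"
    using hh gh gg by (simp del: integral_mult_right_zero)
  finally show ?thesis using cross by (simp add: power2_eq_square)
qed

text \<open>
  By Pythagoras the squared \<open>L\<^sup>2\<close> distances are the increments of a bounded monotone sequence, which
  treats increasing and decreasing fields at once.
\<close>

lemma cond_exp_L1_Cauchy:
  assumes G: "\<And>n. subalgebra M (G n)"
    and mono: "(\<forall>n m. n \<le> m \<longrightarrow> sets (G n) \<subseteq> sets (G m)) \<or> (\<forall>n m. n \<le> m \<longrightarrow> sets (G m) \<subseteq> sets (G n))"
    and f: "integrable M f" and bdd: "AE x in M. \<bar>f x\<bar> \<le> C" and e: "0 < e"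
  shows "\<exists>N::nat. \<forall>n\<ge>N. \<forall>m\<ge>N. (\<integral>x. \<bar>real_cond_exp M (G n) f x - real_cond_exp M (G m) f x\<bar> \<partial>M) \<le> e"
proof -
  define X where "X n = real_cond_exp M (G n) f" for n
  define a where "a n = (\<integral>x. (X n x)\<^sup>2 \<partial>M)" for n
  have X[measurable]: "X n \<in> borel_measurable M" for n unfolding X_def by simp
  have b: "AE x in M. \<bar>X n x\<bar> \<le> C" for n unfolding X_def by (rule cond_exp_bounded[OF G f bdd])
  have b2: "AE x in M. \<bar>(X n x)\<^sup>2\<bar> \<le> C\<^sup>2" for n
    using b[of n] by eventually_elim (metis abs_ge_zero abs_power2 power2_abs power_mono)
  have Xint: "integrable M (X n)" for n by (rule bounded_integrable[OF X b])
  have X2int: "integrable M (\<lambda>x. (X n x)\<^sup>2)" for n by (rule bounded_integrable[OF _ b2]) simp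
  have D2int: "integrable M (\<lambda>x. (X n x - X m x)\<^sup>2)" for n m
  proof (rule bounded_integrable[of _ "(2 * C)\<^sup>2"])
    show "AE x in M. \<bar>(X n x - X m x)\<^sup>2\<bar> \<le> (2 * C)\<^sup>2" using b[of n] b[of m]
    proof eventually_elim
      case (elim x)
      then have "\<bar>X n x - X m x\<bar> \<le> 2 * C" by linarith
      then show ?case by (metis abs_ge_zero abs_power2 power2_abs power_mono)
    qed
  qed simp
  have py: "(\<integral>x. (X n x - X m x)\<^sup>2 \<partial>M) = a n - a m" if "sets (G m) \<subseteq> sets (G n)" for n m
    unfolding X_def a_def
    by (rule cond_exp_pythagoras[OF G G _ f bdd]) (use that G in \<open>auto simp: subalgebra_def\<close>)
  have le: "a m \<le> a n" if "sets (G m) \<subseteq> sets (G n)" for n m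
  proof -
    have "0 \<le> (\<integral>x. (X n x - X m x)\<^sup>2 \<partial>M)" by simp
    then show ?thesis unfolding py[OF that] by simp
  qed
  have sq: "(\<integral>x. (X n x - X m x)\<^sup>2 \<partial>M) = \<bar>a n - a m\<bar>" for n m
  proof -
    have "sets (G m) \<subseteq> sets (G n) \<or> sets (G n) \<subseteq> sets (G m)" using mono nat_le_linear by blast
    then show ?thesis
    proof
      assume "sets (G n) \<subseteq> sets (G m)"
      then show ?thesis using py[of n m] le[of n m] by (simp add: power2_commute[of "X n _"])
    qed (use py[of m n] le[of m n] in simp)
  qed
  have "Bseq a"
  proof (rule BseqI')
    fix n
    have "a n \<le> (\<integral>x. C\<^sup>2 \<partial>M)" unfolding a_def
      by (rule integral_mono_AE[OF X2int]) (use b2[of n] in auto)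
    then show "norm (a n) \<le> C\<^sup>2" by (simp add: prob_space a_def)
  qed
  moreover have "monoseq a" unfolding monoseq_def using mono le by blast
  ultimately have "Cauchy a" using Bseq_monoseq_convergent convergent_Cauchy by blast
  \<comment> \<open>The threshold is \<open>e^2\<close> because passing from L2 to L1 takes a square
    root.\<close>
  then obtain N where N: "\<And>n m. n \<ge> N \<Longrightarrow> m \<ge> N \<Longrightarrow> norm (a n - a m) < e\<^sup>2"
    using CauchyD[of a "e\<^sup>2"] e by auto
  have "(\<integral>x. \<bar>X n x - X m x\<bar> \<partial>M) \<le> e" if "n \<ge> N" "m \<ge> N" for n m
  proof -
    have "(\<integral>x. \<bar>X n x - X m x\<bar> \<partial>M) \<le> sqrt \<bar>a n - a m\<bar>"
      using L1_distance_le_L2[OF _ D2int, of n m] Xint sq by simp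
    also have "\<dots> \<le> sqrt (e\<^sup>2)" using N[OF that] by (intro real_sqrt_le_mono) simp
    finally show ?thesis using e by simp
  qed
  then show ?thesis unfolding X_def by blast
qed

text \<open>Set integrals are continuous in L1. The identity is assumed only eventually because, for
  increasing fields, a set \<open>A\<close> belongs to \<open>G n\<close> only from some index
  on.\<close>

lemma set_integral_L1_lim:
  fixes X :: "nat \<Rightarrow> 'a \<Rightarrow> real"
  assumes X: "\<And>n. integrable M (X n)" and g: "integrable M g"
    and lim: "(\<lambda>n. \<integral>x. \<bar>X n x - g x\<bar> \<partial>M) \<longlonglongrightarrow> 0"
    and A[measurable]: "A \<in> sets M" and ev: "\<forall>\<^sub>F n in sequentially. (\<integral>x\<in>A. X n x \<partial>M) = c"
  shows "(\<integral>x\<in>A. g x \<partial>M) = c"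
proof -
  have i: "integrable M (\<lambda>x. indicator A x * X n x)" "integrable M (\<lambda>x. indicator A x * g x)" for n
    using integrable_mult_indicator[OF A X] integrable_mult_indicator[OF A g] by auto
  have "(\<lambda>n. (\<integral>x\<in>A. X n x \<partial>M) - (\<integral>x\<in>A. g x \<partial>M)) \<longlonglongrightarrow> 0"
  proof (rule Lim_null_comparison[OF always_eventually lim], rule allI)
    fix n
    have "norm ((\<integral>x\<in>A. X n x \<partial>M) - (\<integral>x\<in>A. g x \<partial>M)) = \<bar>\<integral>x. indicator A x * X n x - indicator A x * g x \<partial>M\<bar>"
      using i by (simp add: set_lebesgue_integral_def)
    also have "\<dots> \<le> (\<integral>x. \<bar>indicator A x * X n x - indicator A x * g x\<bar> \<partial>M)" by (rule integral_abs_bound)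
    also have "\<dots> \<le> (\<integral>x. \<bar>X n x - g x\<bar> \<partial>M)"
      by (rule integral_mono)
        (use i X g in \<open>auto simp: indicator_def intro!: integrable_abs Bochner_Integration.integrable_diff i[unfolded indicator_def]\<close>)
    finally show "norm ((\<integral>x\<in>A. X n x \<partial>M) - (\<integral>x\<in>A. g x \<partial>M)) \<le> (\<integral>x. \<bar>X n x - g x\<bar> \<partial>M)" .
  qed
  then have "(\<lambda>n. \<integral>x\<in>A. X n x \<partial>M) \<longlonglongrightarrow> (\<integral>x\<in>A. g x \<partial>M)" by (rule Lim_null[THEN iffD2])
  moreover have "(\<lambda>n. \<integral>x\<in>A. X n x \<partial>M) \<longlonglongrightarrow> c" using ev by (rule tendsto_eventually)
  ultimately show ?thesis by (rule LIMSEQ_unique)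
qed

lemma cond_exp_L1_limit:
  assumes G: "\<And>n. subalgebra M (G n)"
    and mono: "(\<forall>n m. n \<le> m \<longrightarrow> sets (G n) \<subseteq> sets (G m)) \<or> (\<forall>n m. n \<le> m \<longrightarrow> sets (G m) \<subseteq> sets (G n))"
    and f: "integrable M f" and bdd: "AE x in M. \<bar>f x\<bar> \<le> C"
  obtains r :: "nat \<Rightarrow> nat" and g where "strict_mono r" "g = (\<lambda>x. lim (\<lambda>k. real_cond_exp M (G (r k)) f x))"
    "integrable M g"
    "(\<lambda>n. \<integral>x. \<bar>real_cond_exp M (G n) f x - g x\<bar> \<partial>M) \<longlonglongrightarrow> 0"
proof -
  obtain r :: "nat \<Rightarrow> nat" where r: "strict_mono r"
    "AE x in M. \<bar>lim (\<lambda>n. real_cond_exp M (G (r n)) f x)\<bar> \<le> C"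
    "(\<lambda>n. \<integral>x. \<bar>real_cond_exp M (G n) f x - lim (\<lambda>k. real_cond_exp M (G (r k)) f x)\<bar> \<partial>M) \<longlonglongrightarrow> 0"
    using bounded_L1_Cauchy[OF borel_measurable_cond_exp2 cond_exp_bounded[OF G f bdd]
      cond_exp_L1_Cauchy[OF G mono f bdd]] by blast
  have "integrable M (\<lambda>x. lim (\<lambda>k. real_cond_exp M (G (r k)) f x))"
    by (rule bounded_integrable[OF _ r(2)]) measurable
  with r show thesis using that by blast
qed

text \<open>The L1 limit is identified by its integrals over sets of \<open>F\<close>. They agree
  with those of \<open>f\<close> on the union of the \<open>G n\<close>, which is closed under
  intersection and generates \<open>F\<close>; a Dynkin argument extends this to
  \<open>F\<close>.\<close>

lemma cond_exp_increasing_L1: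
  assumes G: "\<And>n. subalgebra M (G n)" and mono: "\<And>n m. n \<le> m \<Longrightarrow> sets (G n) \<subseteq> sets (G m)"
    and F: "subalgebra M F" and sets_F: "sets F = sigma_sets (space M) (\<Union>n. sets (G n))"
    and f: "integrable M f" and bdd: "AE x in M. \<bar>f x\<bar> \<le> C"
  shows "(\<lambda>n. \<integral>x. \<bar>real_cond_exp M (G n) f x - real_cond_exp M F f x\<bar> \<partial>M) \<longlonglongrightarrow> 0"
proof -
  interpret F: finite_measure_subalgebra M F by (rule finite_measure_subalgebraI[OF F])
  have "(\<forall>n m. n \<le> m \<longrightarrow> sets (G n) \<subseteq> sets (G m)) \<or> (\<forall>n m. n \<le> m \<longrightarrow> sets (G m) \<subseteq> sets (G n))"
    using mono by blast
  then obtain r g where r: "strict_mono r" and g: "g = (\<lambda>x. lim (\<lambda>k. real_cond_exp M (G (r k)) f x))"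
    "integrable M g" and lim: "(\<lambda>n. \<integral>x. \<bar>real_cond_exp M (G n) f x - g x\<bar> \<partial>M) \<longlonglongrightarrow> 0"
    by (rule cond_exp_L1_limit[OF G _ f bdd])
  have int: "integrable M (real_cond_exp M (G n) f)" for n
    by (rule bounded_integrable[OF _ cond_exp_bounded[OF G f bdd]]) simp
  have space: "space F = space M" "space (G n) = space M" for n using F G by (auto simp: subalgebra_def)
  have GF: "subalgebra F (G n)" for n
    using space unfolding subalgebra_def sets_F by auto
  have g_meas: "g \<in> borel_measurable F" unfolding g(1)
    by (rule borel_measurable_lim_metric) (rule measurable_from_subalg[OF GF borel_measurable_cond_exp])
  have FM: "A \<in> sets M" if "A \<in> sets F" for A using F that by (auto simp: subalgebra_def)
  have stable: "Int_stable (\<Union>n. sets (G n))"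
  proof (rule Int_stableI)
    fix a b assume "a \<in> (\<Union>n. sets (G n))" "b \<in> (\<Union>n. sets (G n))"
    then obtain n m where "a \<in> sets (G n)" "b \<in> sets (G m)" by auto
    then have "a \<in> sets (G (max n m))" "b \<in> sets (G (max n m))"
      using mono[of n "max n m"] mono[of m "max n m"] by auto
    then show "a \<inter> b \<in> (\<Union>n. sets (G n))" by auto
  qed
  have closed: "(\<Union>n. sets (G n)) \<subseteq> Pow (space M)"
    using sets.space_closed space(2) by fastforce
  have "(\<integral>x\<in>A. f x \<partial>M) = (\<integral>x\<in>A. g x \<partial>M)" if "A \<in> sets F" for A
    using stable closed that[unfolded sets_F]
  proof (induction rule: sigma_sets_induct_disjoint)
    case (basic A)
    then obtain n where n: "A \<in> sets (G n)" by auto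
    have AM: "A \<in> sets M" using G n by (auto simp: subalgebra_def)
    have "\<forall>\<^sub>F m in sequentially. (\<integral>x\<in>A. real_cond_exp M (G m) f x \<partial>M) = (\<integral>x\<in>A. f x \<partial>M)"
      using eventually_ge_at_top[of n]
    proof eventually_elim
      case (elim m)
      interpret m: finite_measure_subalgebra M "G m" by (rule finite_measure_subalgebraI[OF G])
      show ?case by (rule m.real_cond_exp_intA[OF f, symmetric]) (use n mono[OF elim] in auto)
    qed
    from set_integral_L1_lim[OF int g(2) lim AM this] show ?case by simp
  next
    case empty show ?case by (simp add: set_lebesgue_integral_def)
  next
    case (compl A)
    have A: "A \<in> sets M" using FM compl(1) sets_F by simp
    have i: "set_integrable M A f" "set_integrable M (space M - A) f" "set_integrable M A g" "set_integrable M (space M - A) g"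
      unfolding set_integrable_def by (rule integrable_mult_indicator; use A f g(2) in simp)+
    \<comment> \<open>The complement case needs agreement on the whole space, which belongs to every
      \<open>G n\<close>.\<close>
    have tot: "(\<integral>x\<in>space M. f x \<partial>M) = (\<integral>x\<in>space M. g x \<partial>M)"
    proof (rule sym, rule set_integral_L1_lim[OF int g(2) lim sets.top], rule always_eventually, rule allI)
      fix n
      interpret n: finite_measure_subalgebra M "G n" by (rule finite_measure_subalgebraI[OF G])
      show "(\<integral>x\<in>space M. real_cond_exp M (G n) f x \<partial>M) = (\<integral>x\<in>space M. f x \<partial>M)"
        by (rule n.real_cond_exp_intA[OF f, symmetric]) (metis sets.top space(2))
    qed
    have "space M = A \<union> (space M - A)" "A \<inter> (space M - A) = {}" using sets.sets_into_space[OF A] by auto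
    then have "(\<integral>x\<in>space M. h x \<partial>M) = (\<integral>x\<in>A. h x \<partial>M) + (\<integral>x\<in>space M - A. h x \<partial>M)"
      if "set_integrable M A h" "set_integrable M (space M - A) h" for h :: "'a \<Rightarrow> real"
      using set_integral_Un[of A "space M - A" M h] that by simp
    from this[OF i(1,2)] this[OF i(3,4)] tot compl(2) show ?case by simp
  next
    case (union A)
    have A: "A i \<in> sets M" for i using union(2) FM sets_F by auto
    have UA: "(\<Union>i. A i) \<in> sets M" using A by auto
    have i: "set_integrable M (\<Union>i. A i) f" "set_integrable M (\<Union>i. A i) g"
      unfolding set_integrable_def by (rule integrable_mult_indicator; use UA f g(2) in simp)+
    have dj: "A i \<inter> A j = {}" if "i \<noteq> j" for i j using union(1) that by (auto simp: disjoint_family_on_def)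
    show ?case
      using lebesgue_integral_countable_add[OF A dj i(1)] lebesgue_integral_countable_add[OF A dj i(2)] union(3) by simp
  qed
  then have ae: "AE x in M. real_cond_exp M F f x = g x"
    by (rule F.real_cond_exp_charact) (use f g g_meas in auto)
  have "(\<integral>x. \<bar>real_cond_exp M (G n) f x - real_cond_exp M F f x\<bar> \<partial>M) = (\<integral>x. \<bar>real_cond_exp M (G n) f x - g x\<bar> \<partial>M)" for n
    using ae by (intro integral_cong_AE) (use g(2) in auto)
  with lim show ?thesis by simp
qed

text \<open>Every set of \<open>F\<close> lies in all \<open>G n\<close>, so the integrals agree at
  once; the point to settle is that the limit is measurable for the intersection.\<close>

lemma cond_exp_decreasing_L1:
  assumes G: "\<And>n. subalgebra M (G n)" and mono: "\<And>n m. n \<le> m \<Longrightarrow> sets (G m) \<subseteq> sets (G n)"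
    and F: "subalgebra M F" and sets_F: "sets F = (\<Inter>n. sets (G n))"
    and f: "integrable M f" and bdd: "AE x in M. \<bar>f x\<bar> \<le> C"
  shows "(\<lambda>n. \<integral>x. \<bar>real_cond_exp M (G n) f x - real_cond_exp M F f x\<bar> \<partial>M) \<longlonglongrightarrow> 0"
proof -
  interpret F: finite_measure_subalgebra M F by (rule finite_measure_subalgebraI[OF F])
  have "(\<forall>n m. n \<le> m \<longrightarrow> sets (G n) \<subseteq> sets (G m)) \<or> (\<forall>n m. n \<le> m \<longrightarrow> sets (G m) \<subseteq> sets (G n))"
    using mono by blast
  then obtain r g where r: "strict_mono r" and g: "g = (\<lambda>x. lim (\<lambda>k. real_cond_exp M (G (r k)) f x))"
    "integrable M g" and lim: "(\<lambda>n. \<integral>x. \<bar>real_cond_exp M (G n) f x - g x\<bar> \<partial>M) \<longlonglongrightarrow> 0"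
    by (rule cond_exp_L1_limit[OF G _ f bdd])
  have int: "integrable M (real_cond_exp M (G n) f)" for n
    by (rule bounded_integrable[OF _ cond_exp_bounded[OF G f bdd]]) simp
  have space: "space F = space M" "space (G n) = space M" for n using F G by (auto simp: subalgebra_def)
  have g_meas_n: "g \<in> borel_measurable (G n)" for n
  proof -
    \<comment> \<open>Dropping the first \<open>n\<close> terms does not change \<open>lim\<close>,
      even where there is no convergence, and the remaining terms are \<open>G n\<close>-measurable
      because \<open>r (k + n)\<close> is at least \<open>n\<close>.\<close>
    have "g = (\<lambda>x. lim (\<lambda>k. real_cond_exp M (G (r (k + n))) f x))"
    proof -
      have "(\<lambda>k. real_cond_exp M (G (r k)) f x) \<longlonglongrightarrow> L \<longleftrightarrow> (\<lambda>k. real_cond_exp M (G (r (k + n))) f x) \<longlonglongrightarrow> L" for x L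
        using LIMSEQ_ignore_initial_segment[of "\<lambda>k. real_cond_exp M (G (r k)) f x" L n]
          LIMSEQ_offset[of "\<lambda>k. real_cond_exp M (G (r k)) f x" n L] by blast
      then show ?thesis unfolding g(1) lim_def by simp
    qed
    moreover have "subalgebra (G n) (G (r (k + n)))" for k
      using space mono[of n "r (k + n)"] seq_suble[OF r, of "k + n"] by (auto simp: subalgebra_def)
    ultimately show ?thesis
      by (simp only:) (rule borel_measurable_lim_metric, rule measurable_from_subalg[OF _ borel_measurable_cond_exp])
  qed
  have g_meas: "g \<in> borel_measurable F"
  proof (rule measurableI)
    fix B :: "real set" assume "B \<in> sets borel"
    then show "g -` B \<inter> space F \<in> sets F"
      using measurable_sets[OF g_meas_n] space by (auto simp: sets_F)
  qed simp
  have "(\<integral>x\<in>A. f x \<partial>M) = (\<integral>x\<in>A. g x \<partial>M)" if A: "A \<in> sets F" for A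
  proof (rule sym, rule set_integral_L1_lim[OF int g(2) lim], goal_cases)
    case 1 show ?case using F A by (auto simp: subalgebra_def)
  next
    case 2
    show ?case
    proof (rule always_eventually, rule allI)
      fix n
      interpret n: finite_measure_subalgebra M "G n" by (rule finite_measure_subalgebraI[OF G])
      show "(\<integral>x\<in>A. real_cond_exp M (G n) f x \<partial>M) = (\<integral>x\<in>A. f x \<partial>M)"
        by (rule n.real_cond_exp_intA[OF f, symmetric]) (use A sets_F in auto)
    qed
  qed
  then have ae: "AE x in M. real_cond_exp M F f x = g x"
    by (rule F.real_cond_exp_charact) (use f g g_meas in auto)
  have "(\<integral>x. \<bar>real_cond_exp M (G n) f x - real_cond_exp M F f x\<bar> \<partial>M) = (\<integral>x. \<bar>real_cond_exp M (G n) f x - g x\<bar> \<partial>M)" for n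
    using ae by (intro integral_cong_AE) (use g(2) in auto)
  with lim show ?thesis by simp
qed

text \<open>The conditions on \<open>\<X>\<close> hold up to null sets, whereas conditional
  expectations refer to actual fields; replacing a set by one that differs from it by a null set
  changes no integral.\<close>

lemma cond_exp_eq_mod_null:
  assumes F: "subalgebra M F" and G: "subalgebra M G" and GF: "sets G \<subseteq> sets F"
    and eq: "\<And>A. A \<in> sets F \<Longrightarrow> \<exists>B\<in>sets G. (A - B) \<union> (B - A) \<in> null_sets M"
    and f: "integrable M f"
  shows "AE x in M. real_cond_exp M F f x = real_cond_exp M G f x"
proof -
  interpret F: finite_measure_subalgebra M F by (rule finite_measure_subalgebraI[OF F])
  interpret G: finite_measure_subalgebra M G by (rule finite_measure_subalgebraI[OF G])
  have sub: "subalgebra F G" using F G GF by (auto simp: subalgebra_def)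
  show ?thesis
  proof (rule F.real_cond_exp_charact)
    show "real_cond_exp M G f \<in> borel_measurable F"
      by (rule measurable_from_subalg[OF sub borel_measurable_cond_exp])
    fix A assume A: "A \<in> sets F"
    then obtain B where B: "B \<in> sets G" "(A - B) \<union> (B - A) \<in> null_sets M" using eq by blast
    have AB: "A \<in> sets M" "B \<in> sets M" using A B F G by (auto simp: subalgebra_def)
    have swap: "(\<integral>x\<in>A. h x \<partial>M) = (\<integral>x\<in>B. h x \<partial>M)" if "h \<in> borel_measurable M" for h :: "'a \<Rightarrow> real"
      unfolding set_lebesgue_integral_def
    proof (rule integral_cong_AE)
      show "AE x in M. indicator A x *\<^sub>R h x = indicator B x *\<^sub>R h x"
        using AE_not_in[OF B(2)] by eventually_elim (auto simp: indicator_def)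
    qed (use AB that in auto)
    show "(\<integral>x\<in>A. f x \<partial>M) = (\<integral>x\<in>A. real_cond_exp M G f x \<partial>M)"
      using swap[of f] swap[of "real_cond_exp M G f"] G.real_cond_exp_intA[OF f B(1)] f by auto
  qed (use f G.real_cond_exp_int in auto)
qed

lemma bounded_L1_approximation:
  fixes f :: "'a \<Rightarrow> real"
  assumes f: "integrable M f" and e: "0 < e"
  obtains h C where "integrable M h" "AE x in M. \<bar>h x\<bar> \<le> C" "(\<integral>x. \<bar>f x - h x\<bar> \<partial>M) \<le> e"
proof -
  define h where "h n x = max (- real n) (min (real n) (f x))" for n x
  have [measurable]: "f \<in> borel_measurable M" using f by auto
  have [measurable]: "h n \<in> borel_measurable M" for n unfolding h_def by measurable
  have b: "\<bar>h n x\<bar> \<le> real n" for n x unfolding h_def by auto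
  have "(\<lambda>n. \<integral>x. \<bar>f x - h n x\<bar> \<partial>M) \<longlonglongrightarrow> (\<integral>x. 0 \<partial>M)"
  proof (rule integral_dominated_convergence[where w="\<lambda>x. \<bar>f x\<bar>"])
    show "AE x in M. (\<lambda>n. \<bar>f x - h n x\<bar>) \<longlonglongrightarrow> 0"
    proof (rule AE_I2, rule tendsto_eventually)
      fix x
      obtain N :: nat where "\<bar>f x\<bar> \<le> real N" using real_arch_simple by blast
      then have "\<bar>f x - h n x\<bar> = 0" if "n \<ge> N" for n
        using of_nat_mono[OF that, where ?'a=real] unfolding h_def by auto
      then show "\<forall>\<^sub>F n in sequentially. \<bar>f x - h n x\<bar> = 0"
        by (auto simp: eventually_sequentially)
    qed
    show "AE x in M. norm \<bar>f x - h n x\<bar> \<le> \<bar>f x\<bar>" for n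
      by (rule AE_I2) (auto simp: h_def)
  qed (use f in auto)
  then have "\<forall>\<^sub>F n in sequentially. (\<integral>x. \<bar>f x - h n x\<bar> \<partial>M) < e"
    using e by (auto dest: order_tendstoD(2))
  then obtain n where "(\<integral>x. \<bar>f x - h n x\<bar> \<partial>M) < e" by (auto simp: eventually_sequentially)
  moreover have "AE x in M. \<bar>h n x\<bar> \<le> real n" using b by auto
  moreover have "integrable M (h n)" by (rule bounded_integrable[OF _ calculation(2)]) simp
  ultimately show thesis using that[of "h n" "real n"] by simp
qed

section \<open>Maximal inequality and almost sure convergence for martingales\<close>

lemma Markov_abs:
  fixes f :: "'a \<Rightarrow> real"
  assumes f: "integrable M f" and c: "0 < c"
  shows "measure M {x\<in>space M. c < \<bar>f x\<bar>} \<le> (\<integral>x. \<bar>f x\<bar> \<partial>M) / c"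
proof -
  have [measurable]: "f \<in> borel_measurable M" using f by auto
  have "measure M {x\<in>space M. c < \<bar>f x\<bar>} \<le> measure M {x\<in>space M. c \<le> \<bar>f x\<bar>}"
    by (rule finite_measure_mono) auto
  also have "\<dots> \<le> (\<integral>x. \<bar>f x\<bar> \<partial>M) / c"
    using integral_Markov_inequality_measure[of M "\<lambda>x. \<bar>f x\<bar>" "{}" c] f c by simp
  finally show ?thesis .
qed

text \<open>\<open>A n\<close> is the event that the martingale first exceeds \<open>c\<close> at
  index \<open>n\<close>. It lies in \<open>G n\<close>, so over it the conditional expectation may
  be replaced by \<open>f\<close>; the events are disjoint, so these integrals add up to at most
  that of \<open>f\<close>.\<close>

lemma Doob_maximal:
  fixes f :: "'a \<Rightarrow> real" and G :: "nat \<Rightarrow> 'a measure"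
  assumes G: "\<And>n. subalgebra M (G n)" and mono: "\<And>n m. n \<le> m \<Longrightarrow> sets (G n) \<subseteq> sets (G m)"
    and f: "integrable M f" and nn: "\<And>x. 0 \<le> f x" and c: "0 < c"
  shows "\<exists>A\<in>sets M. measure M A \<le> (\<integral>x. f x \<partial>M) / c \<and> (\<forall>x\<in>space M - A. \<forall>n. real_cond_exp M (G n) f x \<le> c)"
proof -
  define X where "X n = real_cond_exp M (G n) f" for n
  have space: "space (G n) = space M" for n using G by (auto simp: subalgebra_def)
  have GM: "A \<in> sets M" if "A \<in> sets (G n)" for A n using G that by (auto simp: subalgebra_def)
  have XG: "X k \<in> borel_measurable (G n)" if "k \<le> n" for k n
    unfolding X_def using G space mono[OF that]
    by (intro measurable_from_subalg[OF _ borel_measurable_cond_exp]) (auto simp: subalgebra_def)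
  define A where "A n = {x\<in>space M. c < X n x \<and> (\<forall>k<n. X k x \<le> c)}" for n
  have AG: "A n \<in> sets (G n)" for n
  proof -
    have [measurable]: "X n \<in> borel_measurable (G n)" by (rule XG) simp
    have "{x\<in>space (G n). X k x \<le> c} \<in> sets (G n)" if "k < n" for k
    proof -
      have [measurable]: "X k \<in> borel_measurable (G n)" using that by (intro XG) simp
      show ?thesis by measurable
    qed
    then have "{x\<in>space (G n). \<forall>k\<in>{..<n}. X k x \<le> c} \<in> sets (G n)"
      by (intro sets.sets_Collect_finite_All) auto
    moreover have "{x\<in>space (G n). c < X n x} \<in> sets (G n)" by measurable
    ultimately have "{x\<in>space (G n). c < X n x} \<inter> {x\<in>space (G n). \<forall>k\<in>{..<n}. X k x \<le> c} \<in> sets (G n)"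
      by (rule sets.Int[rotated])
    also have "{x\<in>space (G n). c < X n x} \<inter> {x\<in>space (G n). \<forall>k\<in>{..<n}. X k x \<le> c} = A n"
      unfolding A_def space by auto
    finally show ?thesis .
  qed
  have A[measurable]: "A n \<in> sets M" for n by (rule GM[OF AG])
  have Xint: "integrable M (X n)" for n
  proof -
    interpret n: finite_measure_subalgebra M "G n" by (rule finite_measure_subalgebraI[OF G])
    show ?thesis unfolding X_def by (rule n.real_cond_exp_int(1)[OF f])
  qed
  have ind_int: "integrable M (\<lambda>x. indicator B x * h x)" if "B \<in> sets M" "integrable M h" for B and h :: "'a \<Rightarrow> real"
    using integrable_mult_indicator[OF that] by simp
  have A_le: "c * measure M (A n) \<le> (\<integral>x. indicator (A n) x * f x \<partial>M)" for n
  proof -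
    interpret n: finite_measure_subalgebra M "G n" by (rule finite_measure_subalgebraI[OF G])
    have "c * measure M (A n) = (\<integral>x. indicator (A n) x * c \<partial>M)" by simp
    also have "\<dots> \<le> (\<integral>x. indicator (A n) x * X n x \<partial>M)"
      by (rule integral_mono[OF ind_int[OF A integrable_const] ind_int[OF A Xint]]) (auto simp: A_def indicator_def)
    also have "\<dots> = (\<integral>x. indicator (A n) x * f x \<partial>M)"
      using n.real_cond_exp_intA[OF f AG] by (simp add: X_def set_lebesgue_integral_def)
    finally show ?thesis .
  qed
  have disj: "disjoint_family A"
    unfolding disjoint_family_on_def
  proof (intro ballI impI)
    fix i j :: nat assume "i \<noteq> j"
    then show "A i \<inter> A j = {}"
      by (cases i j rule: linorder_cases) (fastforce simp: A_def)+
  qed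
  have part: "measure M (\<Union>n<N. A n) \<le> (\<integral>x. f x \<partial>M) / c" for N
  proof -
    have "c * measure M (\<Union>n<N. A n) \<le> c * (\<Sum>n<N. measure M (A n))"
      using c by (intro mult_left_mono finite_measure_subadditive_finite) auto
    also have "\<dots> \<le> (\<Sum>n<N. \<integral>x. indicator (A n) x * f x \<partial>M)"
      unfolding sum_distrib_left by (rule sum_mono) (rule A_le)
    also have "\<dots> = (\<integral>x. (\<Sum>n<N. indicator (A n) x * f x) \<partial>M)"
      by (rule Bochner_Integration.integral_sum[symmetric]) (rule ind_int[OF A f])
    also have "\<dots> \<le> (\<integral>x. f x \<partial>M)"
    proof (rule integral_mono[OF _ f])
      show "integrable M (\<lambda>x. \<Sum>n<N. indicator (A n) x * f x)"
        by (rule Bochner_Integration.integrable_sum) (rule ind_int[OF A f])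
      fix x
      have *: "(\<Sum>n<N. indicator (A n) x * f x) = indicator (\<Union>n<N. A n) x * f x"
        using disj by (subst indicator_UN_disjoint) (auto simp: sum_distrib_right disjoint_family_on_def)
      show "(\<Sum>n<N. indicator (A n) x * f x) \<le> f x" unfolding * using nn[of x] by (simp add: indicator_def)
    qed
    finally show ?thesis using c by (simp add: pos_le_divide_eq mult.commute)
  qed
  have "(\<lambda>N. measure M (\<Union>n<N. A n)) \<longlonglongrightarrow> measure M (\<Union>N. \<Union>n<N. A n)"
  proof (rule finite_Lim_measure_incseq)
    show "incseq (\<lambda>N. \<Union>n<N. A n)" by (intro incseq_SucI UN_mono) auto
  qed auto
  then have "measure M (\<Union>N. \<Union>n<N. A n) \<le> (\<integral>x. f x \<partial>M) / c"
    by (rule LIMSEQ_le_const2) (use part in auto)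
  moreover have "X n x \<le> c" if x: "x \<in> space M - (\<Union>N. \<Union>n<N. A n)" for x n
  proof (induction n rule: less_induct)
    case (less n)
    have "x \<notin> A n" using x by blast
    then show ?case using less x by (auto simp: A_def not_less)
  qed
  ultimately show ?thesis unfolding X_def by (intro bexI[of _ "\<Union>N. \<Union>n<N. A n"]) auto
qed

text \<open>A function \<open>g\<close> measurable for some \<open>G m\<close> and close to
  \<open>h\<close> in L1 is unchanged by conditioning on later fields. The distance from the
  martingale to \<open>g\<close> is then at most the conditional expectation of
  \<open>|h - g|\<close>, which Doob's inequality controls; Markov's inequality controls
  \<open>|h - g|\<close> itself.\<close>

lemma Levy_upward:
  fixes f :: "'a \<Rightarrow> real"
  assumes G: "\<And>n. subalgebra M (G n)" and mono: "\<And>n m. n \<le> m \<Longrightarrow> sets (G n) \<subseteq> sets (G m)"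
    and F: "subalgebra M F" and sets_F: "sets F = sigma_sets (space M) (\<Union>n. sets (G n))"
    and f: "integrable M f"
  shows "AE x in M. (\<lambda>n. real_cond_exp M (G n) f x) \<longlonglongrightarrow> real_cond_exp M F f x"
proof -
  interpret F: finite_measure_subalgebra M F by (rule finite_measure_subalgebraI[OF F])
  define h where "h = real_cond_exp M F f"
  have space: "space F = space M" "space (G n) = space M" for n using F G by (auto simp: subalgebra_def)
  have GF: "subalgebra F (G n)" for n
    using space unfolding subalgebra_def sets_F by auto
  have h: "integrable M h" unfolding h_def by (rule F.real_cond_exp_int(1)[OF f])
  have [measurable]: "h \<in> borel_measurable M" using h by auto
  have "AE x in M. (\<lambda>n. real_cond_exp M (G n) f x - h x) \<longlonglongrightarrow> 0"
  proof (rule AE_LIMSEQ_zero_if_small_exceptional_sets)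
    fix c e :: real assume c: "0 < c" and e: "0 < e"
    \<comment> \<open>Two errors of \<open>c * e / 8\<close> bound the integral of
      \<open>|h - g|\<close> by \<open>c * e / 4\<close>; at level \<open>c / 2\<close> each of the
      sets \<open>A\<close> and \<open>B\<close> then has measure at most
      \<open>e / 2\<close>.\<close>
    obtain b C where b: "integrable M b" "AE x in M. \<bar>b x\<bar> \<le> C" "(\<integral>x. \<bar>f x - b x\<bar> \<partial>M) \<le> c * e / 8"
      using bounded_L1_approximation[OF f, of "c * e / 8"] c e by auto
    have "(\<lambda>n. \<integral>x. \<bar>real_cond_exp M (G n) b x - real_cond_exp M F b x\<bar> \<partial>M) \<longlonglongrightarrow> 0"
      by (rule cond_exp_increasing_L1[OF G mono F sets_F b(1,2)])
    then have "\<forall>\<^sub>F n in sequentially. (\<integral>x. \<bar>real_cond_exp M (G n) b x - real_cond_exp M F b x\<bar> \<partial>M) < c * e / 8"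
      by (rule order_tendstoD(2)) (use c e in simp)
    then obtain m where m: "(\<integral>x. \<bar>real_cond_exp M (G m) b x - real_cond_exp M F b x\<bar> \<partial>M) < c * e / 8"
      by (auto simp: eventually_sequentially)
    define g where "g = real_cond_exp M (G m) b"
    interpret m: finite_measure_subalgebra M "G m" by (rule finite_measure_subalgebraI[OF G])
    have g: "integrable M g" unfolding g_def by (rule m.real_cond_exp_int(1)[OF b(1)])
    have Fb: "integrable M (real_cond_exp M F b)" by (rule F.real_cond_exp_int(1)[OF b(1)])
    have d: "integrable M (\<lambda>x. \<bar>h x - g x\<bar>)" using h g by auto
    have [measurable]: "g \<in> borel_measurable M" using g by auto
    have "(\<integral>x. \<bar>h x - g x\<bar> \<partial>M) \<le> (\<integral>x. \<bar>h x - real_cond_exp M F b x\<bar> + \<bar>g x - real_cond_exp M F b x\<bar> \<partial>M)"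
      by (rule integral_mono) (use h g Fb in auto)
    also have "\<dots> = (\<integral>x. \<bar>h x - real_cond_exp M F b x\<bar> \<partial>M) + (\<integral>x. \<bar>g x - real_cond_exp M F b x\<bar> \<partial>M)"
      by (rule Bochner_Integration.integral_add) (use h g Fb in auto)
    also have "\<dots> \<le> c * e / 4"
      using cond_exp_contraction[OF F f b(1)] b(3) m unfolding h_def g_def by linarith
    finally have small: "(\<integral>x. \<bar>h x - g x\<bar> \<partial>M) \<le> c * e / 4" .
    obtain A where A: "A \<in> sets M" "measure M A \<le> (\<integral>x. \<bar>h x - g x\<bar> \<partial>M) / (c / 2)"
      "\<And>x n. x \<in> space M - A \<Longrightarrow> real_cond_exp M (G n) (\<lambda>x. \<bar>h x - g x\<bar>) x \<le> c / 2"
      using Doob_maximal[where c="c / 2" and G=G, OF G mono d] c by auto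
    define B where "B = {x\<in>space M. c / 2 < \<bar>h x - g x\<bar>}"
    have B: "B \<in> sets M" "measure M B \<le> (\<integral>x. \<bar>h x - g x\<bar> \<partial>M) / (c / 2)"
      unfolding B_def using Markov_abs[of "\<lambda>x. h x - g x" "c / 2"] h g c by auto
    have "(\<integral>x. \<bar>h x - g x\<bar> \<partial>M) / (c / 2) \<le> e / 2"
      using small c by (subst pos_divide_le_eq) (auto simp: mult.commute)
    then have "measure M (A \<union> B) \<le> e"
      using measure_Un_le[OF A(1) B(1)] A(2) B(2) by linarith
    moreover have "AE x in M. x \<notin> A \<union> B \<longrightarrow> (\<forall>\<^sub>F n in sequentially. \<bar>real_cond_exp M (G n) f x - h x\<bar> \<le> c)"
    proof -
      have "AE x in M. m \<le> n \<longrightarrow> \<bar>real_cond_exp M (G n) f x - g x\<bar> \<le> real_cond_exp M (G n) (\<lambda>x. \<bar>h x - g x\<bar>) x" for n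
      proof (cases "m \<le> n")
        case True
        interpret n: finite_measure_subalgebra M "G n" by (rule finite_measure_subalgebraI[OF G])
        have "g \<in> borel_measurable (G n)" unfolding g_def
          by (rule measurable_from_subalg[OF _ borel_measurable_cond_exp])
            (use space mono[OF True] in \<open>auto simp: subalgebra_def\<close>)
        then have "AE x in M. real_cond_exp M (G n) g x = g x"
          by (rule n.real_cond_exp_F_meas[OF g])
        moreover have "AE x in M. real_cond_exp M (G n) h x = real_cond_exp M (G n) f x"
          unfolding h_def by (rule n.real_cond_exp_nested_subalg[OF F GF f])
        moreover note n.real_cond_exp_diff[OF h g]
        moreover have "AE x in M. \<bar>real_cond_exp M (G n) (\<lambda>x. h x - g x) x\<bar> \<le> real_cond_exp M (G n) (\<lambda>x. \<bar>h x - g x\<bar>) x"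
          by (rule cond_exp_abs_le[OF G]) (use h g in auto)
        ultimately show ?thesis by eventually_elim simp
      qed simp
      then have "AE x in M. \<forall>n. m \<le> n \<longrightarrow> \<bar>real_cond_exp M (G n) f x - g x\<bar> \<le> real_cond_exp M (G n) (\<lambda>x. \<bar>h x - g x\<bar>) x"
        by (intro AE_all_countable[THEN iffD2] allI)
      with AE_space show ?thesis
      proof eventually_elim
        case (elim x)
        show ?case
        proof
          assume x: "x \<notin> A \<union> B"
          then have "\<bar>h x - g x\<bar> \<le> c / 2" using elim(1) by (auto simp: B_def)
          moreover have "\<bar>real_cond_exp M (G n) f x - g x\<bar> \<le> c / 2" if "n \<ge> m" for n
            using elim(2) A(3)[of x n] x elim(1) that by fastforce
          ultimately have "\<bar>real_cond_exp M (G n) f x - h x\<bar> \<le> c" if "n \<ge> m" for n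
            using that by (smt (verit) field_sum_of_halves)
          then show "\<forall>\<^sub>F n in sequentially. \<bar>real_cond_exp M (G n) f x - h x\<bar> \<le> c"
            by (auto simp: eventually_sequentially)
        qed
      qed
    qed
    ultimately show "\<exists>A\<in>sets M. measure M A \<le> e \<and>
        (AE x in M. x \<notin> A \<longrightarrow> (\<forall>\<^sub>F n in sequentially. \<bar>real_cond_exp M (G n) f x - h x\<bar> \<le> c))"
      using A(1) B(1) by blast
  qed
  then show ?thesis unfolding h_def by (simp add: LIM_zero_iff)
qed

end

section \<open>Shifts of observations\<close>

lemma sets_sigma_sigma_sets:
  "G \<subseteq> Pow \<Omega> \<Longrightarrow> sets (sigma \<Omega> (sigma_sets \<Omega> G)) = sigma_sets \<Omega> G"
  by (rule sigma_algebra.sets_measure_of_eq[OF sigma_algebra_sigma_sets])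

locale invertible_system = prob_space M for M :: "'a measure" +
  fixes T :: "'a \<Rightarrow> 'a"
  assumes invertible: "invertible_mpt M T"
begin

sublocale measure_preserving_system M T
  using invertible by unfold_locales (auto simp: invertible_mpt_def)

abbreviation S :: "int \<Rightarrow> 'a \<Rightarrow> 'a" where "S \<equiv> iterate M T"

abbreviation (input) T' :: "'a \<Rightarrow> 'a" where "T' \<equiv> inv_into (space M) T"

lemma T_T': "x \<in> space M \<Longrightarrow> T (T' x) = x" and T'_T: "x \<in> space M \<Longrightarrow> T' (T x) = x"
  using invertible unfolding invertible_mpt_def bij_betw_def
  by (auto intro: f_inv_into_f inv_into_f_f)

lemma T'_measurable: "T' \<in> measurable M M"
  using invertible by (auto simp: invertible_mpt_def)

lemma S_of_nat: "S (int k) = T ^^ k"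
  by (simp add: iterate_def)

lemma S_0: "S 0 x = x"
  by (simp add: iterate_def)

lemma S_measurable [measurable]: "S p \<in> measurable M M"
proof -
  have "f ^^ n \<in> measurable M M" if "f \<in> measurable M M" for f n
  proof (induction n)
    case (Suc n)
    show ?case using measurable_comp[OF Suc that] by (simp only: funpow.simps)
  qed (simp add: id_def)
  then show ?thesis unfolding iterate_def using T_measurable T'_measurable by simp
qed

lemma S_space: "x \<in> space M \<Longrightarrow> S p x \<in> space M"
  using measurable_space[OF S_measurable] .

lemma S_Suc: assumes "x \<in> space M" shows "S (p + 1) x = T (S p x)"
proof (cases "p \<ge> 0")
  case True
  then have "nat (p + 1) = Suc (nat p)" by simp
  then show ?thesis using True by (simp add: iterate_def)
next
  case False
  then obtain n where n: "p = - int (Suc n)" by (metis int_cases not_le of_nat_0_le_iff)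
  have "S p x = T' (S (p + 1) x)" unfolding n by (cases n) (auto simp: iterate_def nat_add_distrib)
  then show ?thesis using T_T'[OF S_space[OF assms]] by simp
qed

lemma S_pred: assumes "x \<in> space M" shows "S (p - 1) x = T' (S p x)"
  using S_Suc[OF assms, of "p - 1"] T'_T[OF S_space[OF assms]] by simp

lemma S_add: assumes "x \<in> space M" shows "S (p + q) x = S p (S q x)"
proof (induction p rule: int_induct[where k=0])
  case base show ?case by (simp add: S_0)
next
  case (step1 i)
  have "S (i + 1 + q) x = T (S (i + q) x)" using S_Suc[OF assms, of "i + q"] by (simp add: ac_simps)
  then show ?case using step1 S_Suc[OF S_space[OF assms]] by simp
next
  case (step2 i)
  have "S (i - 1 + q) x = T' (S (i + q) x)" using S_pred[OF assms, of "i + q"] by (simp add: algebra_simps)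
  then show ?case using step2 S_pred[OF S_space[OF assms]] by simp
qed

lemma S_inverse: "x \<in> space M \<Longrightarrow> S p (S (- p) x) = x" "x \<in> space M \<Longrightarrow> S (- p) (S p x) = x"
  using S_add[of x p "- p"] S_add[of x "- p" p] by (auto simp: S_0)

text \<open>Shift fields are defined by images; as pullbacks under the opposite power they become
  accessible to measurability arguments.\<close>

lemma S_image: assumes "A \<subseteq> space M" shows "S p ` A = S (- p) -` A \<inter> space M"
proof (intro equalityI subsetI)
  fix x assume "x \<in> S p ` A"
  then show "x \<in> S (- p) -` A \<inter> space M" using assms S_inverse(2) S_space by auto
next
  fix x assume x: "x \<in> S (- p) -` A \<inter> space M"
  then have "x = S p (S (- p) x)" using S_inverse(1) by simp
  with x show "x \<in> S p ` A" by blast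
qed

lemma distr_S: "distr M M (S p) = M"
proof -
  have pos: "distr M M (T ^^ n) = M" for n
  proof (induction n)
    case (Suc n)
    have "T ^^ n \<in> measurable M M" using S_measurable[of "int n"] by (simp add: S_of_nat)
    then have "distr (distr M M (T ^^ n)) M T = distr M M (T \<circ> T ^^ n)"
      by (intro distr_distr) simp_all
    then show ?case using Suc distr_T by (simp only: funpow.simps)
  qed (simp add: distr_id[unfolded id_def] id_def)
  show ?thesis
  proof (cases "p \<ge> 0")
    case True
    then show ?thesis using pos by (simp add: iterate_def)
  next
    case False
    then obtain n where n: "p = - int n" by (metis int_cases2 le_cases of_nat_0_le_iff)
    \<comment> \<open>Since \<open>M\<close> is already invariant under the positive power,
      inserting it is free, and it cancels \<open>S p\<close>.\<close>
    have "distr M M (S p) = distr (distr M M (S (int n))) M (S p)" using pos by (simp add: S_of_nat)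
    also have "\<dots> = distr M M (S p \<circ> S (int n))" by (rule distr_distr) auto
    also have "\<dots> = distr M M (\<lambda>x. x)"
      by (rule distr_cong) (auto simp: n S_inverse)
    finally show ?thesis by (simp add: distr_id[unfolded id_def])
  qed
qed

lemma integral_S: "f \<in> borel_measurable M \<Longrightarrow> (\<integral>x. f (S p x) \<partial>M) = (\<integral>x. f x \<partial>M)" for f :: "'a \<Rightarrow> real"
  using integral_distr[OF S_measurable, of f p] distr_S by simp

lemma integrable_S: "integrable M f \<Longrightarrow> integrable M (\<lambda>x. f (S p x))" for f :: "'a \<Rightarrow> real"
  using integrable_distr[OF S_measurable, of p f] distr_S by simp

lemma AE_S: "AE x in M. P x \<Longrightarrow> AE x in M. P (S p x)"
  using AE_distrD[OF S_measurable, of P p] by (simp only: distr_S)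

lemma shift_field_eq:
  assumes "\<A> \<subseteq> Pow (space M)"
  shows "shift_field M T p \<A> = (\<lambda>A. S (- p) -` A \<inter> space M) ` \<A>"
  unfolding shift_field_def using assms by (intro image_cong refl S_image) auto

lemma S_vimage: "S p -` (S q -` A \<inter> space M) \<inter> space M = S (q + p) -` A \<inter> space M"
  using S_add S_space by auto

text \<open>Measurability is tested on generators. The \<open>sigma_sets\<close> layer inside
  \<open>sigma\<close> is there because the fields are collections already closed under
  generation.\<close>

lemma S_measurable_sigma:
  assumes A: "\<A> \<subseteq> Pow (space M)" and B: "\<B> \<subseteq> Pow (space M)"
    and "\<And>a. a \<in> \<A> \<Longrightarrow> S p -` a \<inter> space M \<in> sigma_sets (space M) \<B>"
  shows "S p \<in> measurable (sigma (space M) (sigma_sets (space M) \<B>)) (sigma (space M) (sigma_sets (space M) \<A>))"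
proof -
  have "sigma (space M) (sigma_sets (space M) \<A>) = sigma (space M) \<A>"
    using A sigma_sets_into_sp[OF A] by (intro sigma_eqI) (auto simp: sigma_sets_sigma_sets_eq)
  moreover have "S p \<in> measurable (sigma (space M) (sigma_sets (space M) \<B>)) (sigma (space M) \<A>)"
  proof (rule measurable_measure_of[OF A])
    fix a assume "a \<in> \<A>"
    moreover have "sets (sigma (space M) (sigma_sets (space M) \<B>)) = sigma_sets (space M) \<B>"
      by (rule sets_sigma_sigma_sets[OF B])
    ultimately show "S p -` a \<inter> space (sigma (space M) (sigma_sets (space M) \<B>))
        \<in> sets (sigma (space M) (sigma_sets (space M) \<B>))"
      using assms(3) by (simp add: space_measure_of_conv)
  qed (use S_space in \<open>auto simp: space_measure_of_conv\<close>)
  ultimately show ?thesis by simp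
qed

end

section \<open>Fields of observations and stationarity\<close>

locale observed_system = invertible_system M T for M :: "'a measure" and T +
  fixes \<Y> :: "'a set set"
  assumes obs_sub: "sub_field M \<Y>"
begin

lemma Y_sets: "\<Y> \<subseteq> sets M"
  using obs_sub by (simp add: sub_field_def)

lemma Y_Pow: "\<Y> \<subseteq> Pow (space M)"
  using Y_sets sets.sets_into_space by blast

definition obs_gen :: "int set \<Rightarrow> 'a set set" where
  "obs_gen I = {S k -` y \<inter> space M | k y. k \<in> I \<and> y \<in> \<Y>}"

abbreviation obs :: "int set \<Rightarrow> 'a measure" where
  "obs I \<equiv> sigma (space M) (obs_field M T \<Y> I)"

lemma obs_gen_sets: "obs_gen I \<subseteq> sets M"
  unfolding obs_gen_def using Y_sets measurable_sets[OF S_measurable] by auto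

lemma obs_gen_Pow: "obs_gen I \<subseteq> Pow (space M)"
  unfolding obs_gen_def by auto

lemma obs_field_eq: "obs_field M T \<Y> I = sigma_sets (space M) (obs_gen I)"
proof -
  have "(\<Union>k\<in>I. shift_field M T (- k) \<Y>) = obs_gen I"
    unfolding obs_gen_def by (auto simp: shift_field_eq[OF Y_Pow])
  then show ?thesis by (simp add: obs_field_def join_fields_def)
qed

lemma sets_obs: "sets (obs I) = obs_field M T \<Y> I"
  unfolding obs_field_eq by (rule sets_sigma_sigma_sets[OF obs_gen_Pow])

lemma space_obs: "space (obs I) = space M"
  by (simp add: space_measure_of_conv)

lemma obs_mono: "I \<subseteq> J \<Longrightarrow> obs_field M T \<Y> I \<subseteq> obs_field M T \<Y> J"
  unfolding obs_field_eq by (intro sigma_sets_mono') (auto simp: obs_gen_def)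

lemma subalgebra_obs: "subalgebra M (obs I)"
  unfolding subalgebra_def sets_obs space_obs
  using sets.sigma_sets_subset[OF obs_gen_sets] by (simp add: obs_field_eq)

text \<open>What is observed at time \<open>j\<close> from the point \<open>S p x\<close> is what is
  observed at time \<open>j + p\<close> from \<open>x\<close>.\<close>

lemma S_obs:
  assumes "\<And>j. j \<in> J \<Longrightarrow> j + p \<in> I"
  shows "S p \<in> measurable (obs I) (obs J)"
  unfolding obs_field_eq
proof (rule S_measurable_sigma[OF obs_gen_Pow obs_gen_Pow])
  fix a assume "a \<in> obs_gen J"
  then obtain k y where "a = S k -` y \<inter> space M" "k \<in> J" "y \<in> \<Y>" by (auto simp: obs_gen_def)
  then have "S p -` a \<inter> space M \<in> obs_gen I" unfolding obs_gen_def
    using assms[of k] S_vimage[of p k y] by auto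
  then show "S p -` a \<inter> space M \<in> sigma_sets (space M) (obs_gen I)" by (rule sigma_sets.Basic)
qed

text \<open>A generator of the infinite past concerns a single time \<open>k\<close>, so it already
  appears in the finite window reaching back to \<open>k\<close>.\<close>

lemma Levy_obs:
  assumes f: "integrable M f"
  shows "AE x in M. (\<lambda>n. real_cond_exp M (obs {- int n..0}) f x) \<longlonglongrightarrow> real_cond_exp M (obs {..0}) f x"
proof (rule Levy_upward[OF subalgebra_obs _ subalgebra_obs _ f])
  show "sets (obs {- int n..0}) \<subseteq> sets (obs {- int m..0})" if "n \<le> m" for n m
    unfolding sets_obs using that by (intro obs_mono) auto
  show "sets (obs {..0}) = sigma_sets (space M) (\<Union>n. sets (obs {- int n..0}))"
  proof
    have "obs_gen {..0} \<subseteq> (\<Union>n. sets (obs {- int n..0}))"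
    proof
      fix a assume "a \<in> obs_gen {..0}"
      then obtain k y where a: "a = S k -` y \<inter> space M" "k \<le> 0" "y \<in> \<Y>" by (auto simp: obs_gen_def)
      then have "a \<in> obs_gen {- int (nat (- k))..0}" by (auto simp: obs_gen_def)
      then have "a \<in> sets (obs {- int (nat (- k))..0})" unfolding sets_obs unfolding obs_field_eq by (rule sigma_sets.Basic)
      then show "a \<in> (\<Union>n. sets (obs {- int n..0}))" by (rule UN_I[OF UNIV_I])
    qed
    then have "sigma_sets (space M) (obs_gen {..0}) \<subseteq> sigma_sets (space M) (\<Union>n. sets (obs {- int n..0}))"
      by (rule sigma_sets_mono')
    then show "sets (obs {..0}) \<subseteq> sigma_sets (space M) (\<Union>n. sets (obs {- int n..0}))"
      using sets_obs[of "{..0}"] obs_field_eq[of "{..0}"] by simp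
    have "(\<Union>n. sets (obs {- int n..0})) \<subseteq> sets (obs {..0})"
      unfolding sets_obs by (intro UN_least obs_mono) auto
    then show "sigma_sets (space M) (\<Union>n. sets (obs {- int n..0})) \<subseteq> sets (obs {..0})"
      using sets.sigma_sets_subset[of _ "obs {..0}"] space_obs by simp
  qed
qed

text \<open>Stationarity: conditional expectations over the growing horizon \<open>0..k\<close>
  become functions of windows ending at time 0, read along the orbit. A test set is pulled back by
  \<open>S (- k)\<close> into the window \<open>-k..0\<close>, and invariance preserves the
  integrals.\<close>

lemma cond_exp_shift:
  assumes f: "integrable M f"
  shows "AE x in M. real_cond_exp M (obs {0..int k}) (\<lambda>x. f (S (int k) x)) x
    = real_cond_exp M (obs {- int k..0}) f (S (int k) x)"
proof -
  interpret A: finite_measure_subalgebra M "obs {0..int k}" by (rule finite_measure_subalgebraI[OF subalgebra_obs])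
  interpret B: finite_measure_subalgebra M "obs {- int k..0}" by (rule finite_measure_subalgebraI[OF subalgebra_obs])
  let ?g = "real_cond_exp M (obs {- int k..0}) f"
  have g: "integrable M ?g" by (rule B.real_cond_exp_int(1)[OF f])
  show ?thesis
  proof (rule A.real_cond_exp_charact)
    show "integrable M (\<lambda>x. f (S (int k) x))" by (rule integrable_S[OF f])
    show "integrable M (\<lambda>x. ?g (S (int k) x))" by (rule integrable_S[OF g])
    show "(\<lambda>x. ?g (S (int k) x)) \<in> borel_measurable (obs {0..int k})"
      by (rule measurable_compose[OF S_obs borel_measurable_cond_exp]) auto
    fix A assume A: "A \<in> sets (obs {0..int k})"
    then have AM: "A \<in> sets M" using subalgebra_obs by (auto simp: subalgebra_def)
    define B where "B = S (- int k) -` A \<inter> space M"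
    have "S (- int k) \<in> measurable (obs {- int k..0}) (obs {0..int k})" by (rule S_obs) auto
    from measurable_sets[OF this A] have B: "B \<in> sets (obs {- int k..0})" by (simp add: B_def space_obs)
    have BM: "B \<in> sets M" using B subalgebra_obs by (auto simp: subalgebra_def)
    have sw: "(\<integral>x\<in>A. h (S (int k) x) \<partial>M) = (\<integral>x\<in>B. h x \<partial>M)" if h: "h \<in> borel_measurable M" for h :: "'a \<Rightarrow> real"
    proof -
      have "(\<integral>x\<in>A. h (S (int k) x) \<partial>M) = (\<integral>x. indicator B (S (int k) x) *\<^sub>R h (S (int k) x) \<partial>M)"
        unfolding set_lebesgue_integral_def
        by (rule Bochner_Integration.integral_cong) (auto simp: B_def indicator_def S_inverse S_space)
      also have "\<dots> = (\<integral>x\<in>B. h x \<partial>M)"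
        unfolding set_lebesgue_integral_def by (rule integral_S) (use h BM in measurable)
      finally show ?thesis .
    qed
    show "(\<integral>x\<in>A. f (S (int k) x) \<partial>M) = (\<integral>x\<in>A. ?g (S (int k) x) \<partial>M)"
      using sw[of f] sw[of ?g] B.real_cond_exp_intA[OF f B] f g by auto
  qed
qed

end

section \<open>The conditional law of large numbers\<close>

locale conditional_K_system = observed_system M T \<Y> for M :: "'a measure" and T \<Y> +
  fixes \<X> :: "'a set set"
  assumes X_sub: "sub_field M \<X>"
    and X_shift: "\<X> \<subseteq> shift_field M T (- 1) \<X>"
    and X_generates: "field_eq_mod M (join_fields M {1..} (\<lambda>k. shift_field M T (- k) \<X>)) (sets M)"
    and X_tail: "field_eq_mod M (\<Inter>k\<in>{1..}. join2 M (obs_field M T \<Y> {..0}) (shift_field M T k \<X>)) (obs_field M T \<Y> {..0})"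
begin

lemma X_sets: "\<X> \<subseteq> sets M"
  using X_sub by (simp add: sub_field_def)

lemma X_Pow: "\<X> \<subseteq> Pow (space M)"
  using X_sets sets.sets_into_space by blast

lemma shift_X_eq: "shift_field M T p \<X> = (\<lambda>A. S (- p) -` A \<inter> space M) ` \<X>"
  by (rule shift_field_eq[OF X_Pow])

text \<open>Iterating the inclusion of \<open>\<X>\<close> in its backward shift gives any number of
  steps from \<open>\<X>\<close>; the general case is a shift of this one.\<close>

lemma shift_X_antimono: assumes "i \<le> j" shows "shift_field M T j \<X> \<subseteq> shift_field M T i \<X>"
proof -
  have "\<exists>b\<in>\<X>. a = S (int n) -` b \<inter> space M" if "a \<in> \<X>" for a n
    using that
  proof (induction n arbitrary: a)
    case 0
    then show ?case using X_Pow by (intro bexI[of _ a]) (auto simp: S_0)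
  next
    case (Suc n)
    then obtain b where b: "b \<in> \<X>" "a = S (int n) -` b \<inter> space M" by blast
    obtain c where "c \<in> \<X>" "b = S 1 -` c \<inter> space M" using b(1) X_shift by (auto simp: shift_X_eq)
    then show ?case using b S_vimage[of "int n" 1 c] by (auto simp: add.commute intro!: bexI[of _ c])
  qed
  from this[of _ "nat (j - i)"] have *: "\<exists>b\<in>\<X>. a = S (j - i) -` b \<inter> space M" if "a \<in> \<X>" for a
    using assms that by simp
  show ?thesis
  proof
    fix x assume "x \<in> shift_field M T j \<X>"
    then obtain a where a: "a \<in> \<X>" "x = S (- j) -` a \<inter> space M" by (auto simp: shift_X_eq)
    obtain b where b: "b \<in> \<X>" "a = S (j - i) -` b \<inter> space M" using *[OF a(1)] by blast
    have "x = S (- i) -` b \<inter> space M" using a(2) b(2) S_vimage[of "- j" "j - i" b] by simp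
    with b(1) show "x \<in> shift_field M T i \<X>" by (auto simp: shift_X_eq)
  qed
qed

text \<open>\<open>W_field\<close> has the literal shape of the tail condition, while
  \<open>W_gen\<close> lists generators of the same field on which the effect of a shift can be
  checked.\<close>

definition W_gen :: "int \<Rightarrow> 'a set set" where
  "W_gen j = obs_gen {..0} \<union> shift_field M T j \<X>"

definition W_field :: "int \<Rightarrow> 'a set set" where
  "W_field j = join2 M (obs_field M T \<Y> {..0}) (shift_field M T j \<X>)"

abbreviation W :: "int \<Rightarrow> 'a measure" where
  "W j \<equiv> sigma (space M) (W_field j)"

lemma W_gen_sets: "W_gen j \<subseteq> sets M"
  unfolding W_gen_def shift_X_eq using obs_gen_sets X_sets measurable_sets[OF S_measurable] by auto

lemma W_gen_Pow: "W_gen j \<subseteq> Pow (space M)"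
  using W_gen_sets sets.sets_into_space by blast

lemma W_field_eq: "W_field j = sigma_sets (space M) (W_gen j)"
  unfolding W_field_def join2_def obs_field_eq W_gen_def
proof (rule sigma_sets_eqI)
  fix a assume "a \<in> sigma_sets (space M) (obs_gen {..0}) \<union> shift_field M T j \<X>"
  then show "a \<in> sigma_sets (space M) (obs_gen {..0} \<union> shift_field M T j \<X>)"
    using sigma_sets_mono'[of "obs_gen {..0}" "obs_gen {..0} \<union> shift_field M T j \<X>" "space M"] by auto
qed (auto intro: sigma_sets.Basic)

lemma sets_W: "sets (W j) = W_field j"
  unfolding W_field_eq by (rule sets_sigma_sigma_sets[OF W_gen_Pow])

lemma space_W: "space (W j) = space M"
  by (simp add: space_measure_of_conv)

lemma subalgebra_W: "subalgebra M (W j)"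
  unfolding subalgebra_def sets_W space_W
  using sets.sigma_sets_subset[OF W_gen_sets] by (simp add: W_field_eq)

lemma W_antimono: "i \<le> j \<Longrightarrow> W_field j \<subseteq> W_field i"
  unfolding W_field_eq using shift_X_antimono[of i j] by (intro sigma_sets_mono') (auto simp: W_gen_def)

lemma obs_le_W: "obs_field M T \<Y> {..0} \<subseteq> W_field j"
  unfolding W_field_eq obs_field_eq by (intro sigma_sets_mono') (auto simp: W_gen_def)

lemma subalgebra_W_obs: "subalgebra (W j) (obs {..0})"
  unfolding subalgebra_def sets_W space_W sets_obs space_obs using obs_le_W by simp

text \<open>For \<open>p\<close> at most 0, past observations stay in the past and
  \<open>T^j \<X>\<close> is pulled back to \<open>T^(j - p) \<X>\<close>. A shift by at least one
  step thus gains an index, from \<open>W j\<close> to \<open>W (j + 1)\<close>; this gain is the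
  source of orthogonality.\<close>

lemma S_W:
  assumes "p \<le> 0" "i \<le> j - p"
  shows "S p \<in> measurable (W i) (W j)"
  unfolding W_field_eq
proof (rule S_measurable_sigma[OF W_gen_Pow W_gen_Pow])
  fix a assume "a \<in> W_gen j"
  then have "S p -` a \<inter> space M \<in> W_gen i" unfolding W_gen_def
  proof
    assume "a \<in> obs_gen {..0}"
    then obtain k y where "a = S k -` y \<inter> space M" "k \<le> 0" "y \<in> \<Y>" by (auto simp: obs_gen_def)
    then have "S p -` a \<inter> space M = S (k + p) -` y \<inter> space M" "k + p \<in> {..0}" "y \<in> \<Y>"
      using assms S_vimage[of p k y] by simp_all
    then have "S p -` a \<inter> space M \<in> obs_gen {..0}" unfolding obs_gen_def by blast
    then show "S p -` a \<inter> space M \<in> obs_gen {..0} \<union> shift_field M T i \<X>" by simp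
  next
    assume "a \<in> shift_field M T j \<X>"
    then obtain b where "a = S (- j) -` b \<inter> space M" "b \<in> \<X>" by (auto simp: shift_X_eq)
    then have "S p -` a \<inter> space M \<in> shift_field M T (j - p) \<X>"
      using S_vimage[of p "- j" b] by (auto simp: shift_X_eq algebra_simps)
    then show "S p -` a \<inter> space M \<in> obs_gen {..0} \<union> shift_field M T i \<X>"
      using shift_X_antimono[OF assms(2)] by auto
  qed
  then show "S p -` a \<inter> space M \<in> sigma_sets (space M) (W_gen i)" by (rule sigma_sets.Basic)
qed

text \<open>The fields \<open>W (- n)\<close> increase and together contain all backward shifts of
  \<open>\<X>\<close>; by the generating condition they exhaust \<open>M\<close> up to null sets,
  and given \<open>M\<close> the function is its own conditional expectation.\<close>

lemma cond_exp_W_past: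
  assumes f: "integrable M f" and bdd: "AE x in M. \<bar>f x\<bar> \<le> C"
  shows "(\<lambda>n. \<integral>x. \<bar>f x - real_cond_exp M (W (- int n)) f x\<bar> \<partial>M) \<longlonglongrightarrow> 0"
proof -
  define \<F> where "\<F> = sigma_sets (space M) (\<Union>n. sets (W (- int n)))"
  define F where "F = sigma (space M) \<F>"
  have gen: "(\<Union>n. sets (W (- int n))) \<subseteq> sets M" using subalgebra_W by (auto simp: subalgebra_def)
  have genP: "(\<Union>n. sets (W (- int n))) \<subseteq> Pow (space M)" using gen sets.sets_into_space by blast
  have sets_F: "sets F = \<F>" unfolding F_def \<F>_def by (rule sets_sigma_sigma_sets[OF genP])
  have F: "subalgebra M F"
    unfolding subalgebra_def sets_F using sets.sigma_sets_subset[OF gen]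
    by (simp add: F_def \<F>_def space_measure_of_conv)
  have M: "subalgebra M M" by (simp add: subalgebra_def)
  interpret M: finite_measure_subalgebra M M by (rule finite_measure_subalgebraI[OF M])
  have lim: "(\<lambda>n. \<integral>x. \<bar>real_cond_exp M (W (- int n)) f x - real_cond_exp M F f x\<bar> \<partial>M) \<longlonglongrightarrow> 0"
    by (rule cond_exp_increasing_L1[OF subalgebra_W _ F _ f bdd])
      (use W_antimono sets_F in \<open>auto simp: sets_W \<F>_def\<close>)
  have "AE x in M. real_cond_exp M M f x = real_cond_exp M F f x"
  proof (rule cond_exp_eq_mod_null[OF M F _ _ f])
    show "sets F \<subseteq> sets M" using F by (simp add: subalgebra_def)
    fix A assume "A \<in> sets M"
    then obtain B where B: "B \<in> join_fields M {1..} (\<lambda>k. shift_field M T (- k) \<X>)"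
      "(B - A) \<union> (A - B) \<in> null_sets M"
      using X_generates unfolding field_eq_mod_def by blast
    have "(\<Union>k\<in>{1..}. shift_field M T (- k) \<X>) \<subseteq> (\<Union>n. sets (W (- int n)))"
    proof (rule UN_least)
      fix k :: int assume "k \<in> {1..}"
      then have "shift_field M T (- k) \<X> = shift_field M T (- int (nat k)) \<X>" by simp
      also have "\<dots> \<subseteq> sets (W (- int (nat k)))"
        unfolding sets_W unfolding W_field_eq W_gen_def by (auto intro: sigma_sets.Basic)
      also have "\<dots> \<subseteq> (\<Union>n. sets (W (- int n)))" by (rule UN_upper) simp
      finally show "shift_field M T (- k) \<X> \<subseteq> (\<Union>n. sets (W (- int n)))" .
    qed
    then have "B \<in> sets F" using B(1) unfolding sets_F \<F>_def join_fields_def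
      by (meson sigma_sets_mono' subsetD)
    then show "\<exists>B\<in>sets F. (A - B) \<union> (B - A) \<in> null_sets M" using B(2) by (auto simp: Un_commute)
  qed
  moreover have "AE x in M. real_cond_exp M M f x = f x"
    by (rule M.real_cond_exp_F_meas[OF f]) (use f in auto)
  ultimately have ae: "AE x in M. real_cond_exp M F f x = f x" by eventually_elim simp
  have "(\<integral>x. \<bar>real_cond_exp M (W (- int n)) f x - real_cond_exp M F f x\<bar> \<partial>M)
      = (\<integral>x. \<bar>f x - real_cond_exp M (W (- int n)) f x\<bar> \<partial>M)" for n
  proof (rule integral_cong_AE)
    show "AE x in M. \<bar>real_cond_exp M (W (- int n)) f x - real_cond_exp M F f x\<bar> = \<bar>f x - real_cond_exp M (W (- int n)) f x\<bar>"
      using ae by eventually_elim (simp add: abs_minus_commute)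
  qed (use f in auto)
  with lim show ?thesis by simp
qed

text \<open>The fields decrease to the intersection in the tail condition, which is the field of
  past observations up to null sets. The index is \<open>n + 1\<close> because that intersection
  runs over \<open>k\<close> from 1.\<close>

lemma cond_exp_W_future:
  assumes f: "integrable M f" and bdd: "AE x in M. \<bar>f x\<bar> \<le> C"
  shows "(\<lambda>n. \<integral>x. \<bar>real_cond_exp M (W (int n + 1)) f x - real_cond_exp M (obs {..0}) f x\<bar> \<partial>M) \<longlonglongrightarrow> 0"
proof -
  define \<F> where "\<F> = (\<Inter>n. sets (W (int n + 1)))"
  define F where "F = sigma (space M) \<F>"
  have \<F>_eq: "\<F> = (\<Inter>k\<in>{1..}. W_field k)"
  proof -
    have "(\<Inter>n. W_field (int n + 1)) \<subseteq> W_field k" if "k \<ge> 1" for k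
    proof -
      have "W_field k = W_field (int (nat (k - 1)) + 1)" using that by simp
      then show ?thesis by (metis INF_lower UNIV_I)
    qed
    then show ?thesis unfolding \<F>_def sets_W by (intro equalityI INT_greatest INT_lower) auto
  qed
  have "sigma_algebra (space M) \<F>"
    unfolding sigma_algebra_iff2
  proof (intro conjI ballI allI impI)
    show "\<F> \<subseteq> Pow (space M)"
      using order_trans[OF INT_lower[OF UNIV_I, of "\<lambda>n. sets (W (int n + 1))" 0] sets.space_closed]
      unfolding \<F>_def space_W .
    show "space M - s \<in> \<F>" if "s \<in> \<F>" for s
      using that sets.compl_sets[of s "W _"] by (auto simp: \<F>_def space_W)
    show "(\<Union>i. A i) \<in> \<F>" if "range A \<subseteq> \<F>" for A :: "nat \<Rightarrow> 'a set"
      using that unfolding \<F>_def by (intro INT_I sets.countable_nat_UN) blast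
  qed (simp add: \<F>_def)
  then have sets_F: "sets F = \<F>" unfolding F_def by (rule sigma_algebra.sets_measure_of_eq)
  have F: "subalgebra M F"
    unfolding subalgebra_def sets_F using subalgebra_W
    by (auto simp: F_def \<F>_def space_measure_of_conv subalgebra_def)
  have lim: "(\<lambda>n. \<integral>x. \<bar>real_cond_exp M (W (int n + 1)) f x - real_cond_exp M F f x\<bar> \<partial>M) \<longlonglongrightarrow> 0"
    by (rule cond_exp_decreasing_L1[OF subalgebra_W _ F _ f bdd])
      (use W_antimono sets_F in \<open>auto simp: sets_W \<F>_def\<close>)
  have ae: "AE x in M. real_cond_exp M F f x = real_cond_exp M (obs {..0}) f x"
  proof (rule cond_exp_eq_mod_null[OF F subalgebra_obs _ _ f])
    show "sets (obs {..0}) \<subseteq> sets F" unfolding sets_F sets_obs \<F>_eq using obs_le_W by auto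
    fix A assume "A \<in> sets F"
    then have "A \<in> (\<Inter>k\<in>{1..}. join2 M (obs_field M T \<Y> {..0}) (shift_field M T k \<X>))"
      unfolding sets_F \<F>_eq W_field_def .
    then show "\<exists>B\<in>sets (obs {..0}). (A - B) \<union> (B - A) \<in> null_sets M"
      using X_tail unfolding field_eq_mod_def sets_obs by blast
  qed
  have "(\<integral>x. \<bar>real_cond_exp M (W (int n + 1)) f x - real_cond_exp M F f x\<bar> \<partial>M)
      = (\<integral>x. \<bar>real_cond_exp M (W (int n + 1)) f x - real_cond_exp M (obs {..0}) f x\<bar> \<partial>M)" for n
  proof (rule integral_cong_AE)
    show "AE x in M. \<bar>real_cond_exp M (W (int n + 1)) f x - real_cond_exp M F f x\<bar>
        = \<bar>real_cond_exp M (W (int n + 1)) f x - real_cond_exp M (obs {..0}) f x\<bar>"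
      using ae by eventually_elim simp
  qed auto
  with lim show ?thesis by simp
qed

text \<open>The difference \<open>d\<close> of consecutive conditional expectations is bounded and
  has mean zero given \<open>W (j + 1)\<close>; its weighted values along the orbit satisfy the
  hypotheses of \<open>SLLN_bounded_orthogonal\<close>.\<close>

lemma LLN_one_step:
  assumes b: "integrable M b" and bdd: "AE x in M. \<bar>b x\<bar> \<le> C"
    and \<phi>: "\<And>k. \<phi> k \<in> borel_measurable (obs {0..int k})" and \<phi>_le: "\<And>k x. \<bar>\<phi> k x\<bar> \<le> (1::real)"
  shows "AE x in M. (\<lambda>N. (\<Sum>k=1..N. \<phi> k x *
    (real_cond_exp M (W j) b (S (int k) x) - real_cond_exp M (W (j + 1)) b (S (int k) x))) / real N) \<longlonglongrightarrow> 0"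
proof -
  define d where "d x = real_cond_exp M (W j) b x - real_cond_exp M (W (j + 1)) b x" for x
  interpret W0: finite_measure_subalgebra M "W j" by (rule finite_measure_subalgebraI[OF subalgebra_W])
  interpret W1: finite_measure_subalgebra M "W (j + 1)" by (rule finite_measure_subalgebraI[OF subalgebra_W])
  have sub: "subalgebra (W j) (W (j + 1))"
    unfolding subalgebra_def sets_W space_W using W_antimono[of j "j + 1"] by simp
  have d_W: "d \<in> borel_measurable (W j)"
    unfolding d_def using measurable_from_subalg[OF sub borel_measurable_cond_exp] by measurable
  have d[measurable]: "d \<in> borel_measurable M" unfolding d_def by measurable
  have \<phi>_M[measurable]: "\<phi> k \<in> borel_measurable M" for k
    by (rule measurable_from_subalg[OF subalgebra_obs \<phi>])
  have bddW: "AE x in M. \<bar>real_cond_exp M (W i) b x\<bar> \<le> C" for i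
    by (rule cond_exp_bounded[OF subalgebra_W b bdd])
  have d_bdd: "AE x in M. \<bar>d x\<bar> \<le> 2 * C"
    using bddW[of j] bddW[of "j + 1"] by eventually_elim (auto simp: d_def)
  have \<psi>_bdd: "\<bar>\<phi> i y * \<phi> k z * c\<bar> \<le> \<bar>c\<bar>" for i k y z c
    using \<phi>_le[of i y] \<phi>_le[of k z] mult_le_one[of "\<bar>\<phi> i y\<bar>" "\<bar>\<phi> k z\<bar>"]
    by (simp add: abs_mult mult_left_le_one_le)
  have "AE x in M. (\<lambda>N. (\<Sum>k=1..N. \<phi> k x * d (S (int k) x)) / real N) \<longlonglongrightarrow> 0"
  proof (rule SLLN_bounded_orthogonal[where C="2 * C"])
    show "(\<lambda>x. \<phi> k x * d (S (int k) x)) \<in> borel_measurable M" for k by measurable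
    have "AE x in M. \<bar>d (S (int k) x)\<bar> \<le> 2 * C" for k by (rule AE_S[OF d_bdd])
    then have "AE x in M. \<forall>k. \<bar>d (S (int k) x)\<bar> \<le> 2 * C" by (intro AE_all_countable[THEN iffD2] allI)
    then show "AE x in M. \<forall>k. \<bar>\<phi> k x * d (S (int k) x)\<bar> \<le> 2 * C"
    proof eventually_elim
      case (elim x)
      show ?case
      proof
        fix k
        have "\<bar>\<phi> k x\<bar> * \<bar>d (S (int k) x)\<bar> \<le> 1 * (2 * C)"
          using elim \<phi>_le[of k x] by (intro mult_mono) auto
        then show "\<bar>\<phi> k x * d (S (int k) x)\<bar> \<le> 2 * C" by (simp add: abs_mult)
      qed
    qed
    fix i k :: nat assume ik: "1 \<le> i" "i < k"
    \<comment> \<open>Shifting by \<open>-k\<close> moves all other factors into the smaller field \<open>W (j + 1)\<close>, on which \<open>d\<close> has mean zero.\<close>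
    define \<psi> where "\<psi> x = \<phi> i (S (- int k) x) * \<phi> k (S (- int k) x) * d (S (int i - int k) x)" for x
    have \<psi>_W1: "\<psi> \<in> borel_measurable (W (j + 1))"
    proof -
      have "(\<lambda>x. \<phi> i' (S (- int k) x)) \<in> borel_measurable (W (j + 1))" if "i' \<le> k" for i'
      proof (rule measurable_from_subalg[OF subalgebra_W_obs])
        have "S (- int k) \<in> measurable (obs {..0}) (obs {0..int i'})" using that by (intro S_obs) auto
        then show "(\<lambda>x. \<phi> i' (S (- int k) x)) \<in> borel_measurable (obs {..0})"
          by (rule measurable_compose[OF _ \<phi>])
      qed
      \<comment> \<open>Here \<open>i < k\<close> matters: the shift goes back by at least one step,
        which raises \<open>j\<close> to \<open>j + 1\<close>.\<close>
      moreover have "S (int i - int k) \<in> measurable (W (j + 1)) (W j)" using ik by (intro S_W) auto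
      then have "(\<lambda>x. d (S (int i - int k) x)) \<in> borel_measurable (W (j + 1))"
        by (rule measurable_compose[OF _ d_W])
      ultimately show ?thesis unfolding \<psi>_def using ik by (intro borel_measurable_times) auto
    qed
    have \<psi>_W0: "\<psi> \<in> borel_measurable (W j)" by (rule measurable_from_subalg[OF sub \<psi>_W1])
    have \<psi>_M[measurable]: "\<psi> \<in> borel_measurable M" by (rule measurable_from_subalg[OF subalgebra_W \<psi>_W1])
    have \<psi>b: "integrable M (\<lambda>x. \<psi> x * b x)"
    proof (rule bounded_integrable[of _ "2 * C * C"])
      show "(\<lambda>x. \<psi> x * b x) \<in> borel_measurable M" using b by measurable
      show "AE x in M. \<bar>\<psi> x * b x\<bar> \<le> 2 * C * C"
        using AE_S[OF d_bdd, of "int i - int k"] bdd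
      proof eventually_elim
        case (elim x)
        have "\<bar>\<psi> x\<bar> \<le> 2 * C" unfolding \<psi>_def using elim(1) \<psi>_bdd order_trans by blast
        then have "\<bar>\<psi> x\<bar> * \<bar>b x\<bar> \<le> 2 * C * C" using elim(2) by (intro mult_mono) auto
        then show ?case by (simp add: abs_mult)
      qed
    qed
    have "(\<integral>x. \<phi> i x * d (S (int i) x) * (\<phi> k x * d (S (int k) x)) \<partial>M)
      = (\<integral>x. \<phi> i (S (- int k) x) * d (S (int i) (S (- int k) x)) * (\<phi> k (S (- int k) x) * d (S (int k) (S (- int k) x))) \<partial>M)"
      by (rule integral_S[symmetric, of "\<lambda>x. \<phi> i x * d (S (int i) x) * (\<phi> k x * d (S (int k) x))"]) measurable
    also have "\<dots> = (\<integral>x. \<psi> x * d x \<partial>M)"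
    proof (rule Bochner_Integration.integral_cong)
      fix x assume "x \<in> space M"
      then have "S (int k) (S (- int k) x) = x" "S (int i) (S (- int k) x) = S (int i - int k) x"
        using S_inverse S_add[of x "int i" "- int k"] by auto
      then show "\<phi> i (S (- int k) x) * d (S (int i) (S (- int k) x)) * (\<phi> k (S (- int k) x) * d (S (int k) (S (- int k) x)))
        = \<psi> x * d x" by (simp add: \<psi>_def)
    qed simp
    also have "\<dots> = (\<integral>x. \<psi> x * real_cond_exp M (W j) b x - \<psi> x * real_cond_exp M (W (j + 1)) b x \<partial>M)"
      by (simp add: d_def algebra_simps)
    also have "\<dots> = (\<integral>x. \<psi> x * real_cond_exp M (W j) b x \<partial>M) - (\<integral>x. \<psi> x * real_cond_exp M (W (j + 1)) b x \<partial>M)"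
      by (rule Bochner_Integration.integral_diff)
        (use W0.real_cond_exp_intg(1)[OF \<psi>b \<psi>_W0] W1.real_cond_exp_intg(1)[OF \<psi>b \<psi>_W1] b in auto)
    \<comment> \<open>\<open>\<psi>\<close> is measurable for both fields, so both integrals equal
      that of \<open>\<psi> * b\<close>.\<close>
    also have "\<dots> = 0"
      using W0.real_cond_exp_intg(2)[OF \<psi>b \<psi>_W0] W1.real_cond_exp_intg(2)[OF \<psi>b \<psi>_W1] b by auto
    finally show "(\<integral>x. \<phi> i x * d (S (int i) x) * (\<phi> k x * d (S (int k) x)) \<partial>M) = 0" .
  qed
  then show ?thesis unfolding d_def .
qed

lemma LLN_telescope:
  assumes b: "integrable M b" and bdd: "AE x in M. \<bar>b x\<bar> \<le> C"
    and \<phi>: "\<And>k. \<phi> k \<in> borel_measurable (obs {0..int k})" and \<phi>_le: "\<And>k x. \<bar>\<phi> k x\<bar> \<le> (1::real)"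
  shows "AE x in M. (\<lambda>N. (\<Sum>k=1..N. \<phi> k x *
    (real_cond_exp M (W j) b (S (int k) x) - real_cond_exp M (W (j + int n)) b (S (int k) x))) / real N) \<longlonglongrightarrow> 0"
proof (induction n)
  case (Suc n)
  have "AE x in M. (\<lambda>N. (\<Sum>k=1..N. \<phi> k x *
    (real_cond_exp M (W (j + int n)) b (S (int k) x) - real_cond_exp M (W (j + int n + 1)) b (S (int k) x))) / real N) \<longlonglongrightarrow> 0"
    by (rule LLN_one_step[OF b bdd \<phi> \<phi>_le])
  with Suc show ?case
  proof eventually_elim
    case (elim x)
    from tendsto_add[OF elim(1) elim(2)] show ?case
      by (simp add: add_divide_distrib[symmetric] sum.distrib[symmetric] algebra_simps)
  qed
qed simp

text \<open>With weights bounded by 1, replacing one function by another costs at most the orbit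
  average of their distance, so everything outside a finite telescope goes into one function
  \<open>g\<close> of small integral.\<close>

lemma conditional_LLN:
  assumes f: "integrable M f"
    and \<phi>: "\<And>k. \<phi> k \<in> borel_measurable (obs {0..int k})" and \<phi>_le: "\<And>k x. \<bar>\<phi> k x\<bar> \<le> (1::real)"
  shows "AE x in M. (\<lambda>N. (\<Sum>k=1..N. \<phi> k x *
    (f (S (int k) x) - real_cond_exp M (obs {..0}) f (S (int k) x))) / real N) \<longlonglongrightarrow> 0"
proof (rule ergodic_approximation)
  fix e :: real assume e: "0 < e"
  obtain b C where b: "integrable M b" "AE x in M. \<bar>b x\<bar> \<le> C" "(\<integral>x. \<bar>f x - b x\<bar> \<partial>M) \<le> e / 4"
    using bounded_L1_approximation[OF f, of "e / 4"] e by auto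
  let ?E = "\<lambda>i. real_cond_exp M (W i) b"
  let ?Z = "real_cond_exp M (obs {..0})"
  have "\<forall>\<^sub>F n in sequentially. (\<integral>x. \<bar>b x - ?E (- int n) x\<bar> \<partial>M) < e / 4"
    by (rule order_tendstoD(2)[OF cond_exp_W_past[OF b(1,2)]]) (use e in simp)
  then obtain m where m: "(\<integral>x. \<bar>b x - ?E (- int m) x\<bar> \<partial>M) < e / 4" by (auto simp: eventually_sequentially)
  have "\<forall>\<^sub>F n in sequentially. (\<integral>x. \<bar>?E (int n + 1) x - ?Z b x\<bar> \<partial>M) < e / 4"
    by (rule order_tendstoD(2)[OF cond_exp_W_future[OF b(1,2)]]) (use e in simp)
  then obtain n where n: "(\<integral>x. \<bar>?E (int n + 1) x - ?Z b x\<bar> \<partial>M) < e / 4" by (auto simp: eventually_sequentially)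
  have z: "(\<integral>x. \<bar>?Z b x - ?Z f x\<bar> \<partial>M) \<le> e / 4"
  proof (rule order_trans[OF cond_exp_contraction[OF subalgebra_obs b(1) f]])
    show "(\<integral>x. \<bar>b x - f x\<bar> \<partial>M) \<le> e / 4" using b(3) by (simp add: abs_minus_commute)
  qed
  have E_int: "integrable M (?E i)" for i
    by (rule bounded_integrable[OF _ cond_exp_bounded[OF subalgebra_W b(1,2)]]) simp
  interpret Z: finite_measure_subalgebra M "obs {..0}" by (rule finite_measure_subalgebraI[OF subalgebra_obs])
  have Z_int: "integrable M (?Z b)" "integrable M (?Z f)" using Z.real_cond_exp_int(1) b f by auto
  \<comment> \<open>\<open>f - ?Z f\<close> is split at \<open>b\<close>, \<open>?E (- m)\<close>,
    \<open>?E (n + 1)\<close> and \<open>?Z b\<close>. The middle difference is the telescope; the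
    other four, each of integral at most \<open>e / 4\<close>, make up \<open>g\<close>.\<close>
  define g where "g x = \<bar>f x - b x\<bar> + \<bar>b x - ?E (- int m) x\<bar> + \<bar>?E (int n + 1) x - ?Z b x\<bar> + \<bar>?Z b x - ?Z f x\<bar>" for x
  have parts: "integrable M (\<lambda>x. \<bar>f x - b x\<bar>)" "integrable M (\<lambda>x. \<bar>b x - ?E (- int m) x\<bar>)"
    "integrable M (\<lambda>x. \<bar>?E (int n + 1) x - ?Z b x\<bar>)" "integrable M (\<lambda>x. \<bar>?Z b x - ?Z f x\<bar>)"
    by (intro integrable_abs Bochner_Integration.integrable_diff f b E_int Z_int)+
  show "\<exists>g. integrable M g \<and> (\<forall>x. 0 \<le> g x) \<and> (\<integral>x. g x \<partial>M) \<le> e \<and>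
    (AE x in M. \<exists>y. y \<longlonglongrightarrow> 0 \<and> (\<forall>N\<ge>1. \<bar>(\<Sum>k=1..N. \<phi> k x * (f (S (int k) x) - ?Z f (S (int k) x))) / real N\<bar>
      \<le> y N + (\<Sum>k=1..N. g ((T ^^ k) x)) / real N))"
  proof (intro exI[of _ g] conjI allI)
    show "integrable M g" unfolding g_def by (intro Bochner_Integration.integrable_add parts)
    show "0 \<le> g x" for x unfolding g_def by simp
    have "(\<integral>x. g x \<partial>M) = (\<integral>x. \<bar>f x - b x\<bar> \<partial>M) + (\<integral>x. \<bar>b x - ?E (- int m) x\<bar> \<partial>M)
      + (\<integral>x. \<bar>?E (int n + 1) x - ?Z b x\<bar> \<partial>M) + (\<integral>x. \<bar>?Z b x - ?Z f x\<bar> \<partial>M)"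
      unfolding g_def using parts by (simp add: Bochner_Integration.integral_add del: integrable_abs_iff)
    then show "(\<integral>x. g x \<partial>M) \<le> e" using b(3) m n z by linarith
    \<comment> \<open>From index \<open>-m\<close> to index \<open>n + 1\<close> there are
      \<open>m + n + 1\<close> increments.\<close>
    have idx: "- int m + int (m + n + 1) = int n + 1" by simp
    have "AE x in M. (\<lambda>N. (\<Sum>k=1..N. \<phi> k x * (?E (- int m) (S (int k) x) - ?E (int n + 1) (S (int k) x))) / real N) \<longlonglongrightarrow> 0"
      using LLN_telescope[OF b(1,2) \<phi> \<phi>_le, of "- int m" "m + n + 1"] unfolding idx .
    then show "AE x in M. \<exists>y. y \<longlonglongrightarrow> 0 \<and> (\<forall>N\<ge>1. \<bar>(\<Sum>k=1..N. \<phi> k x * (f (S (int k) x) - ?Z f (S (int k) x))) / real N\<bar>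
      \<le> y N + (\<Sum>k=1..N. g ((T ^^ k) x)) / real N)"
    proof eventually_elim
      case (elim x)
      let ?Q = "\<lambda>N. \<Sum>k=1..N. \<phi> k x * (?E (- int m) (S (int k) x) - ?E (int n + 1) (S (int k) x))"
      let ?P = "\<lambda>N. \<Sum>k=1..N. \<phi> k x * (f (S (int k) x) - ?Z f (S (int k) x))"
      have "\<bar>?P N / real N\<bar> \<le> \<bar>?Q N / real N\<bar> + (\<Sum>k=1..N. g ((T ^^ k) x)) / real N" for N
      proof -
        have "\<bar>?P N - ?Q N\<bar> \<le> (\<Sum>k=1..N. g ((T ^^ k) x))"
          unfolding sum_subtractf[symmetric]
        proof (rule order_trans[OF sum_abs], rule sum_mono)
          fix k
          let ?s = "S (int k) x"
          have "\<bar>\<phi> k x * (f ?s - ?Z f ?s) - \<phi> k x * (?E (- int m) ?s - ?E (int n + 1) ?s)\<bar>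
            = \<bar>\<phi> k x\<bar> * \<bar>(f ?s - ?Z f ?s) - (?E (- int m) ?s - ?E (int n + 1) ?s)\<bar>"
            by (simp only: right_diff_distrib[symmetric] abs_mult)
          also have "\<dots> \<le> 1 * \<bar>(f ?s - ?Z f ?s) - (?E (- int m) ?s - ?E (int n + 1) ?s)\<bar>"
            using \<phi>_le by (rule mult_right_mono) simp
          also have "\<dots> \<le> g ?s"
          proof -
            have "\<bar>p - u - (q - r)\<bar> \<le> \<bar>p - s\<bar> + \<bar>s - q\<bar> + \<bar>r - t\<bar> + \<bar>t - u\<bar>" for p q r s t u :: real
              by linarith
            then show ?thesis unfolding g_def by simp
          qed
          finally show "\<bar>\<phi> k x * (f ?s - ?Z f ?s) - \<phi> k x * (?E (- int m) ?s - ?E (int n + 1) ?s)\<bar> \<le> g ((T ^^ k) x)"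
            by (simp add: S_of_nat)
        qed
        then have "\<bar>?P N\<bar> \<le> \<bar>?Q N\<bar> + (\<Sum>k=1..N. g ((T ^^ k) x))" by linarith
        then have "\<bar>?P N\<bar> / real N \<le> (\<bar>?Q N\<bar> + (\<Sum>k=1..N. g ((T ^^ k) x))) / real N"
          by (rule divide_right_mono) simp
        then show ?thesis by (simp add: add_divide_distrib)
      qed
      moreover have "(\<lambda>N. \<bar>?Q N / real N\<bar>) \<longlonglongrightarrow> 0" by (rule tendsto_rabs_zero[OF elim])
      ultimately show ?case by (intro exI[of _ "\<lambda>N. \<bar>?Q N / real N\<bar>"]) blast
    qed
  qed
qed

end

section \<open>Pathwise optimality\<close>

text \<open>By finiteness the intersection \<open>E u\<close> of all measurable sets containing
  \<open>u\<close> is measurable; it is the atom of \<open>u\<close>. For fixed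
  \<open>\<omega>\<close> the loss is measurable in the decision, hence constant on atoms.\<close>

lemma finite_measurable_representatives:
  fixes l :: "'u \<times> 'a \<Rightarrow> real"
  assumes fin: "finite (space U)" and l: "l \<in> borel_measurable (U \<Otimes>\<^sub>M M)"
  shows "\<exists>\<rho>\<in>measurable U (count_space (space U)). \<forall>u\<in>space U. \<forall>\<omega>\<in>space M. l (\<rho> u, \<omega>) = l (u, \<omega>)"
proof -
  define E where "E u = (\<Inter>A\<in>{A \<in> sets U. u \<in> A}. A)" for u
  have fin_sets: "finite (sets U)"
    by (rule finite_subset[OF sets.space_closed]) (use fin in simp)
  have E_sets: "E u \<in> sets U" if "u \<in> space U" for u
    unfolding E_def by (rule sets.finite_INT) (use fin_sets that in auto)
  have E_self: "u \<in> E u" for u unfolding E_def by blast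
  have E_least: "E u \<subseteq> A" if "A \<in> sets U" "u \<in> A" for u A unfolding E_def using that by blast
  have E_eq: "E w = E u" if u: "u \<in> space U" and w: "w \<in> E u" for u w
  proof
    have wU: "w \<in> space U" using w sets.sets_into_space[OF E_sets[OF u]] by blast
    show "E w \<subseteq> E u" by (rule E_least[OF E_sets[OF u] w])
    have "u \<in> E w"
    proof (rule ccontr)
      assume "u \<notin> E w"
      then have "E u \<subseteq> E u - E w"
        using E_sets u wU E_self by (intro E_least sets.Diff) auto
      then show False using w E_self by blast
    qed
    then show "E u \<subseteq> E w" by (rule E_least[OF E_sets[OF wU]])
  qed
  \<comment> \<open>The choice depends on \<open>u\<close> only through \<open>E u\<close>, so
    \<open>\<rho>\<close> is constant on atoms.\<close>
  define \<rho> where "\<rho> u = (SOME w. w \<in> space U \<and> E w = E u)" for u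
  have \<rho>: "\<rho> u \<in> space U" "E (\<rho> u) = E u" if "u \<in> space U" for u
    using someI[of "\<lambda>w. w \<in> space U \<and> E w = E u" u] that unfolding \<rho>_def by auto
  have "\<rho> -` {a} \<inter> space U \<in> sets U" for a
  proof -
    have "\<rho> -` {a} \<inter> space U = (\<Union>u\<in>\<rho> -` {a} \<inter> space U. E u)"
    proof
      show "(\<Union>u\<in>\<rho> -` {a} \<inter> space U. E u) \<subseteq> \<rho> -` {a} \<inter> space U"
      proof safe
        fix u w assume u: "u \<in> space U" and w: "w \<in> E u"
        have "\<rho> w = \<rho> u" unfolding \<rho>_def E_eq[OF u w] ..
        then show "w \<in> \<rho> -` {\<rho> u}" by simp
        show "w \<in> space U" using w sets.sets_into_space[OF E_sets[OF u]] by blast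
      qed
    qed (use E_self in blast)
    also have "\<dots> \<in> sets U" by (rule sets.finite_UN) (use fin E_sets in auto)
    finally show ?thesis .
  qed
  then have "\<rho> \<in> measurable U (count_space (space U))"
    using \<rho>(1) by (simp add: measurable_count_space_eq2[OF fin])
  moreover have "l (\<rho> u, \<omega>) = l (u, \<omega>)" if u: "u \<in> space U" and \<omega>: "\<omega> \<in> space M" for u \<omega>
  proof -
    have [measurable]: "(\<lambda>x. l (x, \<omega>)) \<in> borel_measurable U"
      by (rule measurable_compose[OF measurable_Pair2'[OF \<omega>] l])
    have "{x \<in> space U. l (x, \<omega>) = l (u, \<omega>)} \<in> sets U" by measurable
    then have "E u \<subseteq> {x \<in> space U. l (x, \<omega>) = l (u, \<omega>)}" by (rule E_least) (use u in simp)
    moreover have "\<rho> u \<in> E u" using E_self[of "\<rho> u"] \<rho>(2)[OF u] by simp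
    ultimately show ?thesis by blast
  qed
  ultimately show ?thesis by blast
qed

text \<open>
  The \<open>\<sigma>\<close>-field of \<open>U\<close> need not be discrete; \<open>\<rho>\<close> picks one point of each atom, so that events such as
  \<open>\<rho> (u k x) = a\<close> are measurable.
\<close>

locale decision_problem = conditional_K_system M T \<Y> \<X>
  for M :: "'a measure" and T \<Y> \<X> +
  fixes U :: "'u measure" and l :: "'u \<times> 'a \<Rightarrow> real" and \<Lambda> :: "'a \<Rightarrow> real" and \<rho> :: "'u \<Rightarrow> 'u"
  assumes U_finite: "finite (space U)"
    and l_measurable: "l \<in> borel_measurable (U \<Otimes>\<^sub>M M)"
    and \<Lambda>_integrable: "integrable M \<Lambda>"
    and l_le: "\<And>u \<omega>. u \<in> space U \<Longrightarrow> \<omega> \<in> space M \<Longrightarrow> \<bar>l (u, \<omega>)\<bar> \<le> \<Lambda> \<omega>"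
    and \<rho>_measurable: "\<rho> \<in> measurable U (count_space (space U))"
    and l_\<rho>: "\<And>u \<omega>. u \<in> space U \<Longrightarrow> \<omega> \<in> space M \<Longrightarrow> l (\<rho> u, \<omega>) = l (u, \<omega>)"
begin

definition h :: "'u \<Rightarrow> 'a \<Rightarrow> real" where
  "h a = real_cond_exp M (obs {..0}) (\<lambda>\<omega>. l (a, \<omega>))"

text \<open>At the point \<open>S k x\<close> this is the expected loss of \<open>a\<close> at time
  \<open>k\<close> given the observations with indices \<open>0..k\<close>, by
  \<open>cond_exp_shift\<close>; as \<open>k\<close> grows it tends to \<open>h a\<close> almost
  surely.\<close>

definition h_fin :: "nat \<Rightarrow> 'u \<Rightarrow> 'a \<Rightarrow> real" where
  "h_fin k a = real_cond_exp M (obs {- int k..0}) (\<lambda>\<omega>. l (a, \<omega>))"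

text \<open>The weight vanishes at \<open>k = 0\<close> because strategies are unconstrained there.\<close>

definition choice_ind :: "(nat \<Rightarrow> 'a \<Rightarrow> 'u) \<Rightarrow> 'u \<Rightarrow> nat \<Rightarrow> 'a \<Rightarrow> real" where
  "choice_ind u a k x = (if k \<ge> 1 \<and> \<rho> (u k x) = a then 1 else 0)"

lemma \<rho>_space: "u \<in> space U \<Longrightarrow> \<rho> u \<in> space U"
  using measurable_space[OF \<rho>_measurable] by simp

lemma l_integrable: assumes a: "a \<in> space U" shows "integrable M (\<lambda>\<omega>. l (a, \<omega>))"
proof (rule Bochner_Integration.integrable_bound[OF \<Lambda>_integrable])
  show "(\<lambda>\<omega>. l (a, \<omega>)) \<in> borel_measurable M"
    by (rule measurable_compose[OF measurable_Pair1'[OF a] l_measurable])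
  show "AE \<omega> in M. norm (l (a, \<omega>)) \<le> norm (\<Lambda> \<omega>)"
    by (rule AE_I2) (use l_le[OF a] in force)
qed

lemma h_integrable: assumes "a \<in> space U" shows "integrable M (h a)"
proof -
  interpret Z: finite_measure_subalgebra M "obs {..0}" by (rule finite_measure_subalgebraI[OF subalgebra_obs])
  show ?thesis unfolding h_def by (rule Z.real_cond_exp_int(1)[OF l_integrable[OF assms]])
qed

lemma h_measurable [measurable]: "h a \<in> borel_measurable M" "h_fin k a \<in> borel_measurable M"
  unfolding h_def h_fin_def by simp_all

lemma admissibleD:
  assumes "admissible M T \<Y> U u" "k \<ge> 1"
  shows "u k \<in> measurable (obs {0..int k}) U" "u k \<in> measurable M U"
    "x \<in> space M \<Longrightarrow> u k x \<in> space U"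
proof -
  show *: "u k \<in> measurable (obs {0..int k}) U" using assms by (auto simp: admissible_def decisions_def)
  show "u k \<in> measurable M U" by (rule measurable_from_subalg[OF subalgebra_obs *])
  then show "x \<in> space M \<Longrightarrow> u k x \<in> space U" by (rule measurable_space)
qed

lemma choice_ind_measurable:
  assumes u: "admissible M T \<Y> U u"
  shows "choice_ind u a k \<in> borel_measurable (obs {0..int k})"
proof (cases "k \<ge> 1")
  case True
  have "(\<lambda>b. if b = a then 1 else 0 :: real) \<in> borel_measurable (count_space (space U))" by simp
  from measurable_compose[OF measurable_compose[OF admissibleD(1)[OF u True] \<rho>_measurable] this]
  show ?thesis using True unfolding choice_ind_def[abs_def] by simp
qed (simp add: choice_ind_def[abs_def])

lemma sum_choice_ind:
  assumes u: "admissible M T \<Y> U u" and k: "k \<ge> 1" and x: "x \<in> space M"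
  shows "(\<Sum>a\<in>space U. choice_ind u a k x * F a) = F (\<rho> (u k x))"
proof -
  have "(\<Sum>a\<in>space U. choice_ind u a k x * F a) = (\<Sum>a\<in>space U. if \<rho> (u k x) = a then F a else 0)"
    using k by (intro sum.cong) (auto simp: choice_ind_def)
  also have "\<dots> = F (\<rho> (u k x))"
    using U_finite \<rho>_space[OF admissibleD(3)[OF u k x]] by simp
  finally show ?thesis .
qed

text \<open>For each of the finitely many \<open>a\<close> the weights \<open>choice_ind u a\<close>
  are observable, so \<open>conditional_LLN\<close> applies; summing over \<open>a\<close>
  reassembles the loss. \<open>h\<close> is read at \<open>\<rho> (u k x)\<close> since the weights
  record only the representative of the decision.\<close>

lemma admissible_LLN:
  assumes u: "admissible M T \<Y> U u"
  shows "AE x in M. (\<lambda>N. (\<Sum>k=1..N. l (u k x, S (int k) x) - h (\<rho> (u k x)) (S (int k) x)) / real N) \<longlonglongrightarrow> 0"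
proof -
  have "AE x in M. \<forall>a\<in>space U. (\<lambda>N. (\<Sum>k=1..N. choice_ind u a k x *
      (l (a, S (int k) x) - h a (S (int k) x))) / real N) \<longlonglongrightarrow> 0"
  proof (rule AE_finite_allI[OF U_finite])
    fix a assume a: "a \<in> space U"
    show "AE x in M. (\<lambda>N. (\<Sum>k=1..N. choice_ind u a k x *
      (l (a, S (int k) x) - h a (S (int k) x))) / real N) \<longlonglongrightarrow> 0"
      unfolding h_def
      by (rule conditional_LLN[OF l_integrable[OF a] choice_ind_measurable[OF u]])
        (simp add: choice_ind_def)
  qed
  with AE_space show ?thesis
  proof eventually_elim
    case (elim x)
    have "(\<lambda>N. \<Sum>a\<in>space U. (\<Sum>k=1..N. choice_ind u a k x * (l (a, S (int k) x) - h a (S (int k) x))) / real N)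
      \<longlonglongrightarrow> (\<Sum>a\<in>space U. 0)"
      by (rule tendsto_sum) (use elim(2) in blast)
    moreover have "(\<Sum>a\<in>space U. (\<Sum>k=1..N. choice_ind u a k x * (l (a, S (int k) x) - h a (S (int k) x))) / real N)
      = (\<Sum>k=1..N. l (u k x, S (int k) x) - h (\<rho> (u k x)) (S (int k) x)) / real N" for N
    proof -
      have "(\<Sum>a\<in>space U. (\<Sum>k=1..N. choice_ind u a k x * (l (a, S (int k) x) - h a (S (int k) x))) / real N)
        = (\<Sum>k=1..N. \<Sum>a\<in>space U. choice_ind u a k x * (l (a, S (int k) x) - h a (S (int k) x))) / real N"
        unfolding sum_divide_distrib[symmetric] by (subst sum.swap) simp
      also have "(\<Sum>k=1..N. \<Sum>a\<in>space U. choice_ind u a k x * (l (a, S (int k) x) - h a (S (int k) x)))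
        = (\<Sum>k=1..N. l (u k x, S (int k) x) - h (\<rho> (u k x)) (S (int k) x))"
      proof (rule sum.cong)
        fix k assume "k \<in> {1..N}"
        then have k: "k \<ge> 1" by simp
        show "(\<Sum>a\<in>space U. choice_ind u a k x * (l (a, S (int k) x) - h a (S (int k) x)))
          = l (u k x, S (int k) x) - h (\<rho> (u k x)) (S (int k) x)"
          using sum_choice_ind[OF u k elim(1), of "\<lambda>a. l (a, S (int k) x) - h a (S (int k) x)"]
            l_\<rho>[OF admissibleD(3)[OF u k elim(1)] S_space[OF elim(1)]] by simp
      qed simp
      finally show ?thesis .
    qed
    ultimately show ?case by simp
  qed
qed

text \<open>The decision at time \<open>k\<close> is a function of the observations, so its
  indicator can be taken out of the conditional expectation, one value \<open>a\<close> at a time;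
  stationarity moves what remains to time 0.\<close>

lemma cond_loss_eq:
  assumes u: "admissible M T \<Y> U u" and k: "k \<ge> 1"
  shows "AE x in M. cond_loss M T \<Y> l k (u k) x = h_fin k (\<rho> (u k x)) (S (int k) x)"
proof -
  interpret A: finite_measure_subalgebra M "obs {0..int k}" by (rule finite_measure_subalgebraI[OF subalgebra_obs])
  let ?c = "\<lambda>a x. choice_ind u a k x * l (a, S (int k) x)"
  have ind_M: "choice_ind u a k \<in> borel_measurable M" for a
    by (rule measurable_from_subalg[OF subalgebra_obs choice_ind_measurable[OF u]])
  have lS: "integrable M (\<lambda>x. l (a, S (int k) x))" if "a \<in> space U" for a
    using integrable_S[OF l_integrable[OF that]] by simp
  have c_int: "integrable M (?c a)" if a: "a \<in> space U" for a
  proof (rule Bochner_Integration.integrable_bound[OF lS[OF a]])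
    show "?c a \<in> borel_measurable M"
      by (rule borel_measurable_times[OF ind_M borel_measurable_integrable[OF lS[OF a]]])
    show "AE x in M. norm (?c a x) \<le> norm (l (a, S (int k) x))"
      by (rule AE_I2) (simp add: choice_ind_def)
  qed
  have "loss_at M T l (int k) (u k) \<in> borel_measurable M"
    unfolding loss_at_def[abs_def]
    by (rule measurable_compose[OF measurable_Pair[OF admissibleD(2)[OF u k] S_measurable] l_measurable])
  moreover have sum_meas: "(\<lambda>x. \<Sum>a\<in>space U. ?c a x) \<in> borel_measurable M"
    using c_int by (intro borel_measurable_sum) auto
  moreover have "loss_at M T l (int k) (u k) x = (\<Sum>a\<in>space U. ?c a x)" if x: "x \<in> space M" for x
    using sum_choice_ind[OF u k x, of "\<lambda>a. l (a, S (int k) x)"]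
      l_\<rho>[OF admissibleD(3)[OF u k x] S_space[OF x]] by (simp add: loss_at_def)
  ultimately have 1: "AE x in M. cond_loss M T \<Y> l k (u k) x
      = real_cond_exp M (obs {0..int k}) (\<lambda>x. \<Sum>a\<in>space U. ?c a x) x"
    unfolding cond_loss_def by (intro A.real_cond_exp_cong AE_I2) auto
  \<comment> \<open>Extension by 0 outside \<open>space U\<close>: the sum rule for conditional
    expectations asks for integrability at every index.\<close>
  define c where "c a = (if a \<in> space U then ?c a else (\<lambda>_. 0))" for a
  have c_int': "integrable M (c a)" for a unfolding c_def using c_int by auto
  have "AE x in M. real_cond_exp M (obs {0..int k}) (\<lambda>x. \<Sum>a\<in>space U. c a x) x
      = (\<Sum>a\<in>space U. real_cond_exp M (obs {0..int k}) (c a) x)"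
    by (rule A.real_cond_exp_sum[OF c_int'])
  moreover have "(\<lambda>x. \<Sum>a\<in>space U. c a x) = (\<lambda>x. \<Sum>a\<in>space U. ?c a x)"
    by (intro ext sum.cong) (auto simp: c_def)
  ultimately have 2: "AE x in M. real_cond_exp M (obs {0..int k}) (\<lambda>x. \<Sum>a\<in>space U. ?c a x) x
      = (\<Sum>a\<in>space U. real_cond_exp M (obs {0..int k}) (c a) x)" by simp
  have 3: "AE x in M. \<forall>a\<in>space U. real_cond_exp M (obs {0..int k}) (c a) x = choice_ind u a k x * h_fin k a (S (int k) x)"
  proof (rule AE_finite_allI[OF U_finite])
    fix a assume a: "a \<in> space U"
    have c_a: "c a = ?c a" using a by (simp add: c_def)
    have "AE x in M. real_cond_exp M (obs {0..int k}) (?c a) x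
        = choice_ind u a k x * real_cond_exp M (obs {0..int k}) (\<lambda>x. l (a, S (int k) x)) x"
      by (rule A.real_cond_exp_mult[OF choice_ind_measurable[OF u] _ c_int[OF a]]) (use lS[OF a] in auto)
    moreover have "AE x in M. real_cond_exp M (obs {0..int k}) (\<lambda>x. l (a, S (int k) x)) x = h_fin k a (S (int k) x)"
      unfolding h_fin_def by (rule cond_exp_shift[OF l_integrable[OF a]])
    ultimately show "AE x in M. real_cond_exp M (obs {0..int k}) (c a) x = choice_ind u a k x * h_fin k a (S (int k) x)"
      unfolding c_a by eventually_elim simp
  qed
  from 1 2 3 AE_space show ?thesis
  proof eventually_elim
    case (elim x)
    then show ?case using sum_choice_ind[OF u k elim(4), of "\<lambda>a. h_fin k a (S (int k) x)"] by simp
  qed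
qed

text \<open>Constant decisions are available at every time, so the essential infimum lies below each
  of their conditional losses. Finitely many constants and countably many times leave a single null
  set.\<close>

lemma mean_optimal_h_fin:
  assumes v: "mean_optimal M T \<Y> U l v"
  shows "AE x in M. \<forall>k\<ge>1. \<forall>a\<in>space U.
    h_fin k (\<rho> (v k x)) (S (int k) x) \<le> h_fin k a (S (int k) x) + 1 / real k"
proof -
  have adm: "admissible M T \<Y> U v" using v by (simp add: mean_optimal_def)
  have "AE x in M. k \<ge> 1 \<longrightarrow> (\<forall>a\<in>space U.
    h_fin k (\<rho> (v k x)) (S (int k) x) \<le> h_fin k a (S (int k) x) + 1 / real k)" for k
  proof (cases "k \<ge> 1")
    case k: True
    have "\<exists>g. is_ess_inf M {\<lambda>\<omega>. ereal (cond_loss M T \<Y> l k u \<omega>) | u. u \<in> decisions M T \<Y> U 0 (int k)} g \<and>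
      (AE \<omega> in M. ereal (cond_loss M T \<Y> l k (v k) \<omega>) \<le> g \<omega> + ereal (1 / real k))"
      using v k unfolding mean_optimal_def by simp
    then obtain g where g: "is_ess_inf M {\<lambda>\<omega>. ereal (cond_loss M T \<Y> l k u \<omega>) | u. u \<in> decisions M T \<Y> U 0 (int k)} g"
      "AE \<omega> in M. ereal (cond_loss M T \<Y> l k (v k) \<omega>) \<le> g \<omega> + ereal (1 / real k)"
      by (elim exE conjE)
    have lower: "\<forall>f\<in>{\<lambda>\<omega>. ereal (cond_loss M T \<Y> l k u \<omega>) | u. u \<in> decisions M T \<Y> U 0 (int k)}.
        AE \<omega> in M. g \<omega> \<le> f \<omega>"
      using g(1) unfolding is_ess_inf_def by (elim conjE)
    have "AE x in M. \<forall>a\<in>space U. h_fin k (\<rho> (v k x)) (S (int k) x) \<le> h_fin k a (S (int k) x) + 1 / real k"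
    proof (rule AE_finite_allI[OF U_finite])
      fix a assume a: "a \<in> space U"
      have "(\<lambda>_. a) \<in> decisions M T \<Y> U 0 (int k)" unfolding decisions_def using a by simp
      then have "(\<lambda>\<omega>. ereal (cond_loss M T \<Y> l k (\<lambda>_. a) \<omega>))
          \<in> {\<lambda>\<omega>. ereal (cond_loss M T \<Y> l k u \<omega>) | u. u \<in> decisions M T \<Y> U 0 (int k)}"
        by (intro CollectI exI[of _ "\<lambda>_. a"] conjI refl)
      from bspec[OF lower this] have "AE \<omega> in M. g \<omega> \<le> ereal (cond_loss M T \<Y> l k (\<lambda>_. a) \<omega>)" .
      moreover have "AE \<omega> in M. cond_loss M T \<Y> l k (\<lambda>_. a) \<omega> = h_fin k a (S (int k) \<omega>)"
        unfolding cond_loss_def loss_at_def h_fin_def by (rule cond_exp_shift[OF l_integrable[OF a]])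
      moreover note cond_loss_eq[OF adm k] g(2)
      ultimately show "AE x in M. h_fin k (\<rho> (v k x)) (S (int k) x) \<le> h_fin k a (S (int k) x) + 1 / real k"
      proof eventually_elim
        case (elim x)
        have "ereal (cond_loss M T \<Y> l k (v k) x) \<le> ereal (cond_loss M T \<Y> l k (\<lambda>_. a) x) + ereal (1 / real k)"
          using elim(4) add_right_mono[OF elim(1)] by (rule order_trans)
        then show ?case using elim(2,3) by simp
      qed
    qed
    then show ?thesis by eventually_elim simp
  qed simp
  then have "AE x in M. \<forall>k. k \<ge> 1 \<longrightarrow> (\<forall>a\<in>space U.
    h_fin k (\<rho> (v k x)) (S (int k) x) \<le> h_fin k a (S (int k) x) + 1 / real k)"
    by (intro AE_all_countable[THEN iffD2] allI)
  then show ?thesis by eventually_elim blast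
qed

section \<open>Excess of the mean-optimal decision\<close>

definition H :: "'a \<Rightarrow> real" where
  "H y = (\<Sum>a\<in>space U. \<bar>h a y\<bar>)"

text \<open>The minimum joins a majorant independent of \<open>k\<close> with a bound that tends to
  0. The factors 2 account for the chosen decision and its competitor. At \<open>k = 0\<close> the
  term \<open>1 / real k\<close> is 0; the averages start at \<open>k = 1\<close>.\<close>

definition D :: "nat \<Rightarrow> 'a \<Rightarrow> real" where
  "D k y = min (2 * H y) (2 * (\<Sum>a\<in>space U. \<bar>h_fin k a y - h a y\<bar>) + 1 / real k)"

lemma D_ergodic: "AE x in M. (\<lambda>N. (\<Sum>k=1..N. D k ((T ^^ k) x)) / real N) \<longlonglongrightarrow> 0"
proof (rule maker_ergodic)
  show "D k \<in> borel_measurable M" for k unfolding D_def[abs_def] H_def by measurable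
  show "integrable M (\<lambda>y. 2 * H y)" unfolding H_def using h_integrable by auto
  show nn: "0 \<le> D k x" for k x unfolding D_def H_def by (simp add: sum_nonneg)
  show "D k x \<le> 2 * H x" for k x unfolding D_def by simp
  have "AE x in M. \<forall>a\<in>space U. (\<lambda>k. h_fin k a x) \<longlonglongrightarrow> h a x"
    unfolding h_fin_def h_def by (rule AE_finite_allI[OF U_finite]) (rule Levy_obs[OF l_integrable])
  then show "AE x in M. (\<lambda>k. D k x) \<longlonglongrightarrow> 0"
  proof eventually_elim
    case (elim x)
    have "(\<lambda>k. 2 * (\<Sum>a\<in>space U. \<bar>h_fin k a x - h a x\<bar>) + 1 / real k) \<longlonglongrightarrow> 2 * (\<Sum>a\<in>space U. \<bar>h a x - h a x\<bar>) + 0"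
      by (intro tendsto_intros lim_1_over_n) (use elim in auto)
    then have "(\<lambda>k. 2 * (\<Sum>a\<in>space U. \<bar>h_fin k a x - h a x\<bar>) + 1 / real k) \<longlonglongrightarrow> 0" by simp
    then show ?case
      by (rule Lim_null_comparison[OF always_eventually, rotated]) (use nn in \<open>auto simp: D_def\<close>)
  qed
qed

text \<open>Comparison through the finite past: \<open>h b - h c\<close> is
  \<open>h_fin k b - h_fin k c\<close> plus two approximation errors, each at most the full sum over
  \<open>U\<close>. The other bound uses absolute values only.\<close>

lemma near_optimal_h:
  assumes b: "b \<in> space U" and c: "c \<in> space U"
    and opt: "h_fin k b y \<le> h_fin k c y + 1 / real k"
  shows "h b y - h c y \<le> D k y"
proof -
  have le: "\<bar>F a\<bar> \<le> (\<Sum>a\<in>space U. \<bar>F a\<bar>)" if "a \<in> space U" for a and F :: "'u \<Rightarrow> real"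
    using member_le_sum[of a "space U" "\<lambda>a. \<bar>F a\<bar>"] that U_finite by simp
  have "h b y - h c y \<le> 2 * H y"
    using le[OF b, of "\<lambda>a. h a y"] le[OF c, of "\<lambda>a. h a y"] unfolding H_def by linarith
  moreover have "h b y - h c y \<le> 2 * (\<Sum>a\<in>space U. \<bar>h_fin k a y - h a y\<bar>) + 1 / real k"
    using le[OF b, of "\<lambda>a. h_fin k a y - h a y"] le[OF c, of "\<lambda>a. h_fin k a y - h a y"] opt by linarith
  ultimately show ?thesis unfolding D_def by simp
qed

text \<open>The difference of average losses equals the difference of the remainders in
  \<open>admissible_LLN\<close> minus the average amount by which \<open>h\<close> along
  \<open>v\<close> exceeds \<open>h\<close> along \<open>u\<close>. That amount is bounded above by
  \<open>D\<close> but need not have a limiting average, which is why a lower bound for the liminf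
  results.\<close>

lemma mean_optimal_pathwise_optimal:
  assumes v: "mean_optimal M T \<Y> U l v"
  shows "pathwise_optimal M T \<Y> U l v"
  unfolding pathwise_optimal_def
proof (intro conjI allI impI)
  show adm_v: "admissible M T \<Y> U v" using v by (simp add: mean_optimal_def)
  fix u assume adm_u: "admissible M T \<Y> U u"
  show "AE \<omega> in M. 0 \<le> liminf (\<lambda>N. ereal (average_loss M T l u N \<omega> - average_loss M T l v N \<omega>))"
    using admissible_LLN[OF adm_u] admissible_LLN[OF adm_v] mean_optimal_h_fin[OF v] D_ergodic AE_space
  proof eventually_elim
    case (elim x)
    let ?R = "\<lambda>w N. (\<Sum>k=1..N. l (w k x, S (int k) x) - h (\<rho> (w k x)) (S (int k) x)) / real N"
    let ?D = "\<lambda>N. (\<Sum>k=1..N. D k ((T ^^ k) x)) / real N"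
    have "(\<lambda>N. ?R u N - ?R v N - ?D N) \<longlonglongrightarrow> 0 - 0 - 0"
      by (intro tendsto_diff elim)
    then have "(\<lambda>N. ereal (?R u N - ?R v N - ?D N)) \<longlonglongrightarrow> ereal 0" by simp
    then have "liminf (\<lambda>N. ereal (?R u N - ?R v N - ?D N)) = 0"
      by (simp add: lim_imp_Liminf zero_ereal_def)
    moreover have "?R u N - ?R v N - ?D N \<le> average_loss M T l u N x - average_loss M T l v N x" for N
    proof -
      have "(\<Sum>k=1..N. h (\<rho> (v k x)) (S (int k) x) - h (\<rho> (u k x)) (S (int k) x)) \<le> (\<Sum>k=1..N. D k ((T ^^ k) x))"
      proof (rule sum_mono)
        fix k assume "k \<in> {1..N}"
        then have k: "k \<ge> 1" by simp
        \<comment> \<open>The competitor may vary with time and point: near-optimality holds against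
          every \<open>a\<close> at once, in particular against
          \<open>\<rho> (u k x)\<close>.\<close>
        have "h (\<rho> (v k x)) (S (int k) x) - h (\<rho> (u k x)) (S (int k) x) \<le> D k (S (int k) x)"
          by (intro near_optimal_h \<rho>_space admissibleD(3)[OF adm_v k elim(5)] admissibleD(3)[OF adm_u k elim(5)])
            (use elim(3) k \<rho>_space admissibleD(3)[OF adm_u k elim(5)] in blast)
        then show "h (\<rho> (v k x)) (S (int k) x) - h (\<rho> (u k x)) (S (int k) x) \<le> D k ((T ^^ k) x)"
          by (simp add: S_of_nat)
      qed
      then have "(\<Sum>k=1..N. h (\<rho> (v k x)) (S (int k) x) - h (\<rho> (u k x)) (S (int k) x)) / real N \<le> ?D N"
        by (rule divide_right_mono) simp
      then show ?thesis
        by (simp add: average_loss_def loss_at_def sum_subtractf diff_divide_distrib)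
    qed
    then have "liminf (\<lambda>N. ereal (?R u N - ?R v N - ?D N))
      \<le> liminf (\<lambda>N. ereal (average_loss M T l u N x - average_loss M T l v N x))"
      by (intro Liminf_mono always_eventually allI) simp
    ultimately show ?case by simp
  qed
qed

end

theorem theorem1p7:
  fixes M :: "'a measure" and T :: "'a \<Rightarrow> 'a" and \<Y> :: "'a set set"
    and U :: "'u measure" and l :: "'u \<times> 'a \<Rightarrow> real" and \<Lambda> :: "'a \<Rightarrow> real"
    and v :: "nat \<Rightarrow> 'a \<Rightarrow> 'u"
  assumes "prob_space M"
    and "invertible_mpt M T"
    and "ergodic M T"
    and "sub_field M \<Y>"
    and "conditional_K_automorphism M T (obs_field M T \<Y> {..0})"
    and "finite (space U)"
    and "l \<in> borel_measurable (U \<Otimes>\<^sub>M M)"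
    and "integrable M \<Lambda>"
    and "\<And>u \<omega>. u \<in> space U \<Longrightarrow> \<omega> \<in> space M \<Longrightarrow> \<bar>l (u, \<omega>)\<bar> \<le> \<Lambda> \<omega>"
    and "mean_optimal M T \<Y> U l v"
  shows "pathwise_optimal M T \<Y> U l v"
proof -
  obtain \<X> where \<X>: "sub_field M \<X>" "\<X> \<subseteq> shift_field M T (- 1) \<X>"
    "field_eq_mod M (join_fields M {1..} (\<lambda>k. shift_field M T (- k) \<X>)) (sets M)"
    "field_eq_mod M (\<Inter>k\<in>{1..}. join2 M (obs_field M T \<Y> {..0}) (shift_field M T k \<X>)) (obs_field M T \<Y> {..0})"
    using assms(5) unfolding conditional_K_automorphism_def by blast
  obtain \<rho> where \<rho>: "\<rho> \<in> measurable U (count_space (space U))"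
    "\<And>u \<omega>. u \<in> space U \<Longrightarrow> \<omega> \<in> space M \<Longrightarrow> l (\<rho> u, \<omega>) = l (u, \<omega>)"
    using finite_measurable_representatives[OF assms(6,7)] by blast
  interpret decision_problem M T \<Y> \<X> U l \<Lambda> \<rho>
    using assms \<X> \<rho>
    by (intro decision_problem.intro decision_problem_axioms.intro conditional_K_system.intro
        conditional_K_system_axioms.intro observed_system.intro observed_system_axioms.intro
        invertible_system.intro invertible_system_axioms.intro) auto
  show ?thesis by (rule mean_optimal_pathwise_optimal[OF assms(10)])
qed

end
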